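(* Let $\mathscr{V}\subseteq\mathfrak{B}(\mathcal{H})$ be a linear subspace containing a positive definite operator $V$, and let $\sigma:=\Pi_{\mathcal{Z}({\rm alg}(\mathscr{V}))}[V]$, where $\Pi_{\mathcal{Z}({\rm alg}(\mathscr{V}))}$ is the Hilbert–Schmidt orthogonal projection onto the center $\mathcal{Z}({\rm alg}(\mathscr{V}))$. Then $\sigma$ is positive definite, $\mathscr{V}\subseteq{\rm alg}_\sigma(\mathscr{V})$, $\sigma\sim{\rm alg}(\mathcal{D}_\sigma^{-1}(\mathscr{V}))$ (so that ${\rm alg}_\sigma(\mathscr{V})$ is the image of a state extension), and for every positive definite $\rho$ with $\rho\sim{\rm alg}(\mathcal{D}_\rho^{-1}(\mathscr{V}))$ one has $${\rm alg}_\sigma(\mathscr{V})\subseteq{\rm alg}_\rho(\mathscr{V}).$$ That is, ${\rm alg}_\sigma(\mathscr{V})$ is the minimal distorted algebra containing $\mathscr{V}$ that admits a state extension.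
   Context: $\mathcal{H}$ finite-dimensional complex Hilbert space, $\mathfrak{B}(\mathcal{H})$ its linear operators, $\langle X,Y\rangle_{HS}={\rm tr}(X^\dagger Y)$. A $*$-algebra is a linear subspace of $\mathfrak{B}(\mathcal{H})$ closed under products and adjoints; ${\rm alg}(\mathcal{S})$ is the smallest $*$-algebra containing $\mathcal{S}$. Commutant $\mathscr{A}'=\{X:[X,A]=0\ \forall A\in\mathscr{A}\}$, center $\mathcal{Z}(\mathscr{A})=\mathscr{A}\cap\mathscr{A}'$. For positive definite $\rho$, $\mathcal{D}_\rho(X)=\rho^{1/2}X\rho^{1/2}$, $\mathcal{D}_\rho^{-1}(X)=\rho^{-1/2}X\rho^{-1/2}$. A $\rho$-distorted algebra is a linear subspace closed under adjoints and the product $X\cdot_\rho Y=X\rho^{-1}Y$; ${\rm alg}_\rho(\mathcal{S})$ is the smallest one containing $\mathcal{S}$. Wedderburn decomposition of a unital $*$-algebra $\mathscr{A}$: unitary $U$, $\mathcal{H}\cong\bigoplus_l\mathcal{H}_{S,l}\otimes\mathcal{H}_{F,l}$, $\mathscr{A}=U(\bigoplus_l\mathfrak{B}(\mathcal{H}_{S,l})\otimes I_{F,l})U^\dagger$. Compatibility: $\rho\sim\mathscr{A}$ if for some Wedderburn decomposition of $\mathscr{A}$, $\rho=U(\bigoplus_l\rho_{S,l}\otimes\tau_{F,l})U^\dagger$ with $\rho_{S,l}\in\mathfrak{B}(\mathcal{H}_{S,l})$, $\tau_{F,l}\in\mathfrak{B}(\mathcal{H}_{F,l})$. A conditional expectation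 onto a unital $*$-algebra $\mathscr{A}$ is a CP unital map $\mathbb{E}:\mathfrak{B}(\mathcal{H})\to\mathscr{A}$ with $\mathbb{E}(AB)=A\mathbb{E}(B)$ for $A\in\mathscr{A}$; its state extension is the Hilbert–Schmidt adjoint $\mathbb{E}^\dagger$. A distorted algebra $\mathcal{D}_\rho(\mathscr{A})$ admits a state extension if there is a conditional expectation onto $\mathscr{A}$ whose state extension has image $\mathcal{D}_\rho(\mathscr{A})$ (for positive definite $\rho$ and unital $\mathscr{A}$ this holds iff $\rho\sim\mathscr{A}$). *)

theory Defs
  imports "HOL-Analysis.Analysis"
begin

type_synonym 'n op = "complex ^ 'n ^ 'n"

definition adj :: "'n::finite op \<Rightarrow> 'n op" where
  "adj A = (\<chi> i j. cnj (A $ j $ i))"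

definition cscale :: "complex \<Rightarrow> 'n::finite op \<Rightarrow> 'n op" where
  "cscale c A = (\<chi> i j. c * A $ i $ j)"

definition tr :: "'n::finite op \<Rightarrow> complex" where
  "tr A = (\<Sum>i\<in>UNIV. A $ i $ i)"

definition hs_inner :: "'n::finite op \<Rightarrow> 'n op \<Rightarrow> complex" where
  "hs_inner X Y = tr (adj X ** Y)"

definition csubspace :: "'n::finite op set \<Rightarrow> bool" where
  "csubspace W \<longleftrightarrow> 0 \<in> W \<and> (\<forall>X\<in>W. \<forall>Y\<in>W. X + Y \<in> W) \<and> (\<forall>c. \<forall>X\<in>W. cscale c X \<in> W)"

text \<open>Positive definite: \<open>\<langle>x, A x\<rangle>\<close> is a strictly positive real for every nonzero \<open>x\<close>
  (for complex spaces this forces self-adjointness; we also require it explicitly).\<close>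
definition posdef :: "'n::finite op \<Rightarrow> bool" where
  "posdef A \<longleftrightarrow> adj A = A \<and>
     (\<forall>x::complex^'n. x \<noteq> 0 \<longrightarrow>
        (let q = (\<Sum>i\<in>UNIV. cnj (x $ i) * (A *v x) $ i) in Im q = 0 \<and> Re q > 0))"

definition psqrt :: "'n::finite op \<Rightarrow> 'n op" where
  "psqrt A = (THE B. posdef B \<and> B ** B = A)"

definition Dmap :: "'n::finite op \<Rightarrow> 'n op \<Rightarrow> 'n op" where
  "Dmap \<rho> X = psqrt \<rho> ** X ** psqrt \<rho>"

definition Dinv :: "'n::finite op \<Rightarrow> 'n op \<Rightarrow> 'n op" where
  "Dinv \<rho> X = matrix_inv (psqrt \<rho>) ** X ** matrix_inv (psqrt \<rho>)"

definition star_algebra :: "'n::finite op set \<Rightarrow> bool" where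
  "star_algebra A \<longleftrightarrow> csubspace A \<and> (\<forall>X\<in>A. \<forall>Y\<in>A. X ** Y \<in> A) \<and> (\<forall>X\<in>A. adj X \<in> A)"

definition alg :: "'n::finite op set \<Rightarrow> 'n op set" where
  "alg S = \<Inter>{A. star_algebra A \<and> S \<subseteq> A}"

definition commutant :: "'n::finite op set \<Rightarrow> 'n op set" where
  "commutant A = {X. \<forall>Y\<in>A. X ** Y = Y ** X}"

definition center :: "'n::finite op set \<Rightarrow> 'n op set" where
  "center A = A \<inter> commutant A"

definition hs_proj :: "'n::finite op set \<Rightarrow> 'n op \<Rightarrow> 'n op" where
  "hs_proj W X = (THE P. P \<in> W \<and> (\<forall>Y\<in>W. hs_inner Y (X - P) = 0))"

definition distorted_algebra :: "'n::finite op \<Rightarrow> 'n op set \<Rightarrow> bool" where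
  "distorted_algebra \<rho> A \<longleftrightarrow> csubspace A \<and> (\<forall>X\<in>A. \<forall>Y\<in>A. X ** matrix_inv \<rho> ** Y \<in> A)
      \<and> (\<forall>X\<in>A. adj X \<in> A)"

definition alg_rho :: "'n::finite op \<Rightarrow> 'n op set \<Rightarrow> 'n op set" where
  "alg_rho \<rho> S = \<Inter>{A. distorted_algebra \<rho> A \<and> S \<subseteq> A}"

definition unitary :: "'n::finite op \<Rightarrow> bool" where
  "unitary U \<longleftrightarrow> U ** adj U = mat 1 \<and> adj U ** U = mat 1"

text \<open>A block structure \<open>\<H> \<cong> \<Oplus>\<^sub>l \<H>\<^sub>S\<^sub>,\<^sub>l \<otimes> \<H>\<^sub>F\<^sub>,\<^sub>l\<close>: the standard basis index set \<open>'n\<close> is put in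
  bijection with the triples \<open>(l,s,f)\<close> with \<open>l < L\<close>, \<open>s < dS l\<close>, \<open>f < dF l\<close>
  (block index, index in \<open>\<H>\<^sub>S\<^sub>,\<^sub>l\<close>, index in \<open>\<H>\<^sub>F\<^sub>,\<^sub>l\<close>).\<close>
definition block_struct ::
  "nat \<Rightarrow> (nat \<Rightarrow> nat) \<Rightarrow> (nat \<Rightarrow> nat) \<Rightarrow> ('n::finite \<Rightarrow> nat \<times> nat \<times> nat) \<Rightarrow> bool" where
  "block_struct L dS dF lab \<longleftrightarrow>
     bij_betw lab UNIV {(l, s, f). l < L \<and> s < dS l \<and> f < dF l}"

text \<open>The operator \<open>\<Oplus>\<^sub>l B\<^sub>l \<otimes> C\<^sub>l\<close> in the block basis; \<open>B l\<close> and \<open>C l\<close> are matrices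
  on \<open>\<H>\<^sub>S\<^sub>,\<^sub>l\<close> and \<open>\<H>\<^sub>F\<^sub>,\<^sub>l\<close> given by their entries.\<close>
definition block_tensor ::
  "('n::finite \<Rightarrow> nat \<times> nat \<times> nat) \<Rightarrow> (nat \<Rightarrow> nat \<Rightarrow> nat \<Rightarrow> complex)
     \<Rightarrow> (nat \<Rightarrow> nat \<Rightarrow> nat \<Rightarrow> complex) \<Rightarrow> 'n op" where
  "block_tensor lab B C = (\<chi> i j.
     (case lab i of (l, s, f) \<Rightarrow> case lab j of (l', s', f') \<Rightarrow>
        if l = l' then B l s s' * C l f f' else 0))"

definition wedderburn ::
  "'n::finite op set \<Rightarrow> 'n op \<Rightarrow> nat \<Rightarrow> (nat \<Rightarrow> nat) \<Rightarrow> (nat \<Rightarrow> nat) \<Rightarrow> ('n \<Rightarrow> nat \<times> nat \<times> nat) \<Rightarrow> bool" where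
  "wedderburn A U L dS dF lab \<longleftrightarrow> unitary U \<and> block_struct L dS dF lab \<and>
     A = {U ** block_tensor lab B (\<lambda>l f f'. if f = f' then 1 else 0) ** adj U | B. True}"

definition compatible :: "'n::finite op \<Rightarrow> 'n op set \<Rightarrow> bool" where
  "compatible \<rho> A \<longleftrightarrow> (\<exists>U L dS dF lab. wedderburn A U L dS dF lab \<and>
     (\<exists>\<rho>S \<tau>F. \<rho> = U ** block_tensor lab \<rho>S \<tau>F ** adj U))"

end

(* Let N be a unital *-algebra and tau an invertible element of its commutant such that every element
   of the subspace VV has the form Z tau with Z in N. Put A = alg VV and M = A \<inter> N. The average of V
   over the unitaries of M is a positive definite s in A \<inter> N tau commuting with M. Since X V^-1 lies
   in M for every X in A \<inter> N tau, s commutes with V and then with all of VV. So s is central in A,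
   hence it is the projection sigma of V onto the center, and tau sigma^-1 lies in N, which makes N tau
   a sigma-distorted algebra. If rho is compatible with N = alg(D_rho^-1(VV)), then rho^(1/2) = a b with
   positive a in N and b in N', so that alg_rho(VV) = N b^2 has the form N tau.
   Compatibility of sigma with N = alg(D_sigma^-1(VV)) follows from sigma being in N' and from the
   Wedderburn decomposition of N. *)
theory Submission
  imports Defs
begin

section \<open>Matrices over the complex numbers\<close>

text \<open>The operator \<sigma> is built from \<open>VV\<close> and \<open>V\<close> alone, yet it
  has to lie in \<open>N\<tau>\<close> for every compatible \<rho>, and the center of
  \<open>alg VV\<close> has no visible relation to \<open>N\<close>. This dictates the averaging
  group: conjugation by a unitary of \<open>A\<close> keeps \<open>A\<close> but may leave
  \<open>N\<tau>\<close>, and only unitaries that are also in \<open>N\<close> keep both. The price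
  is that the average is known to commute with \<open>M\<close> alone, so centrality has to be won
  back. Quotients of elements of \<open>N\<tau>\<close> achieve this, because the common factor
  \<tau> cancels from them. Once the average is central, uniqueness of the orthogonal projection
  makes it the same operator for all \<rho>. \<open>compatible\<close> is existential over
  Wedderburn decompositions. For \<rho> the given decomposition only has to yield two commuting
  factors; for \<sigma> a decomposition has to be constructed, which calls for the structure theory
  of minimal projections. The same projections diagonalize positive operators and thereby supply
  square roots, located inside any unital star-algebra that contains the operator.\<close>

definition cip :: "complex^'n::finite \<Rightarrow> complex^'n \<Rightarrow> complex" where
  "cip x y = (\<Sum>i\<in>UNIV. cnj (x $ i) * y $ i)"

lemma cscale_component [simp]: "cscale c A $ i $ j = c * A $ i $ j"
  by (simp add: cscale_def)

lemma adj_component [simp]: "adj A $ i $ j = cnj (A $ j $ i)"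
  by (simp add: adj_def)

lemma adj_adj [simp]: "adj (adj A) = A"
  by (simp add: vec_eq_iff)

lemma adj_mult: "adj (A ** B) = adj B ** adj A"
  by (simp add: vec_eq_iff matrix_matrix_mult_def cnj_sum mult.commute)

lemma adj_add: "adj (A + B) = adj A + adj B"
  by (simp add: vec_eq_iff)

lemma adj_diff: "adj (A - B) = adj A - adj B"
  by (simp add: vec_eq_iff)

lemma adj_zero [simp]: "adj 0 = 0"
  by (simp add: vec_eq_iff)

lemma adj_one [simp]: "adj (mat 1) = mat 1"
  by (auto simp: vec_eq_iff mat_def)

lemma adj_cscale: "adj (cscale c A) = cscale (cnj c) (adj A)"
  by (simp add: vec_eq_iff)

lemma adj_sum: "adj (sum f S) = (\<Sum>x\<in>S. adj (f x))"
  by (induction S rule: infinite_finite_induct) (auto simp: adj_add)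

lemma adj_eq_zero_iff [simp]: "adj A = 0 \<longleftrightarrow> A = 0"
  by (metis adj_adj adj_zero)

lemma cscale_mult_left: "cscale c A ** B = cscale c (A ** B)"
  by (simp add: vec_eq_iff matrix_matrix_mult_def sum_distrib_left mult.assoc)

lemma cscale_mult_right: "A ** cscale c B = cscale c (A ** B)"
  by (simp add: vec_eq_iff matrix_matrix_mult_def sum_distrib_left mult_ac)

lemma cscale_cscale [simp]: "cscale c (cscale d A) = cscale (c * d) A"
  by (simp add: vec_eq_iff)

lemma cscale_one [simp]: "cscale 1 A = A"
  by (simp add: vec_eq_iff)

lemma cscale_zero [simp]: "cscale 0 A = 0"
  by (simp add: vec_eq_iff)

lemma cscale_zero_right [simp]: "cscale c 0 = 0"
  by (simp add: vec_eq_iff)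

lemma cscale_eq_zero_iff: "cscale c A = 0 \<longleftrightarrow> c = 0 \<or> A = 0"
  by (auto simp: vec_eq_iff)

text \<open>Dimension counts and closest points are taken over the reals; through this identity
  complex subspaces become real ones.\<close>

lemma cscale_of_real: "cscale (of_real r) A = r *\<^sub>R A"
  unfolding vec_eq_iff cscale_component vector_scaleR_component by (simp add: scaleR_conv_of_real)

lemma cscale_mv: "cscale c A *v x = c *s (A *v x)"
  by (simp add: vec_eq_iff matrix_vector_mult_def sum_distrib_left mult.assoc)

lemma mult_add_right: "((A::'n op) + B) ** C = A ** C + B ** (C::'n::finite op)"
  by (simp add: vec_eq_iff matrix_matrix_mult_def sum.distrib algebra_simps)

lemma mult_add_left: "A ** (B + C) = A ** B + A ** (C::'n::finite op)"
  by (rule matrix_add_ldistrib)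

lemma mult_diff_right: "((A::'n op) - B) ** C = A ** C - B ** (C::'n::finite op)"
  by (simp add: vec_eq_iff matrix_matrix_mult_def sum_subtractf algebra_simps)

lemma mult_diff_left: "A ** (B - C) = A ** B - A ** (C::'n::finite op)"
  by (simp add: vec_eq_iff matrix_matrix_mult_def sum_subtractf algebra_simps)

lemma mult_zero_left [simp]: "0 ** C = (0::'n::finite op)"
  by (simp add: vec_eq_iff matrix_matrix_mult_def)

lemma mult_zero_right [simp]: "C ** 0 = (0::'n::finite op)"
  by (simp add: vec_eq_iff matrix_matrix_mult_def)

lemma mult_sum_right: "(A::'n op) ** sum f S = (\<Sum>x\<in>S. A ** (f x :: 'n::finite op))"
  by (induction S rule: infinite_finite_induct) (auto simp: mult_add_left)

lemma mult_sum_left: "sum f S ** (A::'n op) = (\<Sum>x\<in>S. (f x :: 'n::finite op) ** A)"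
  by (induction S rule: infinite_finite_induct) (auto simp: mult_add_right)

lemma mult_scaleR_left: "(r *\<^sub>R (A::'n op)) ** B = r *\<^sub>R (A ** (B :: 'n::finite op))"
  by (metis cscale_of_real cscale_mult_left)

lemma mult_scaleR_right: "(A::'n op) ** (r *\<^sub>R B) = r *\<^sub>R (A ** (B :: 'n::finite op))"
  by (metis cscale_of_real cscale_mult_right)

lemmas mult_distribs = mult_add_left mult_add_right mult_diff_left mult_diff_right

lemma linear_mult_left: "linear (\<lambda>X::'n::finite op. (A::'n op) ** X)"
  by (rule linearI) (simp_all add: mult_add_left mult_scaleR_right)

lemma linear_mult_right: "linear (\<lambda>X::'n::finite op. X ** (A::'n op))"
  by (rule linearI) (simp_all add: mult_add_right mult_scaleR_left)

lemma invertible_iff_ker: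
  "invertible (A::'n::finite op) \<longleftrightarrow> (\<forall>x. A *v x = 0 \<longrightarrow> x = 0)"
  by (simp add: invertible_left_inverse matrix_left_invertible_ker)

lemma invertible_inv:
  assumes "invertible (A::'n::finite op)"
  shows "A ** matrix_inv A = mat 1" "matrix_inv A ** A = mat 1"
proof -
  have "\<exists>A'. A ** A' = mat 1 \<and> A' ** A = mat 1"
    using assms by (simp add: invertible_def)
  then show "A ** matrix_inv A = mat 1" "matrix_inv A ** A = mat 1"
    unfolding matrix_inv_def by (rule someI2_ex, simp)+
qed

lemma matrix_inv_unique:
  assumes "A ** B = mat 1"
  shows "matrix_inv (A::'n::finite op) = B"
proof -
  have BA: "B ** A = mat 1" using assms by (simp add: matrix_left_right_inverse)
  then have "invertible A" using assms by (auto simp: invertible_def)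
  have "matrix_inv A = matrix_inv A ** (A ** B)" using assms by simp
  also have "\<dots> = B"
    by (simp add: matrix_mul_assoc invertible_inv(2)[OF \<open>invertible A\<close>])
  finally show ?thesis .
qed

subsection \<open>Inner products\<close>

lemma cip_adj: "cip x (A *v y) = cip (adj A *v x) y"
proof -
  have "cip x (A *v y) = (\<Sum>i\<in>UNIV. \<Sum>j\<in>UNIV. cnj (x $ i) * A $ i $ j * y $ j)"
    by (simp add: cip_def matrix_vector_mult_def sum_distrib_left mult.assoc)
  also have "\<dots> = (\<Sum>j\<in>UNIV. \<Sum>i\<in>UNIV. cnj (x $ i) * A $ i $ j * y $ j)"
    by (rule sum.swap)
  also have "\<dots> = cip (adj A *v x) y"
    by (simp add: cip_def matrix_vector_mult_def sum_distrib_left sum_distrib_right cnj_sum mult_ac)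
  finally show ?thesis .
qed

lemma cip_commute: "cip y x = cnj (cip x y)"
  by (simp add: cip_def cnj_sum mult.commute)

lemma inner_eq_Re_cip: "inner x y = Re (cip x y)"
  by (simp add: inner_vec_def cip_def inner_complex_def)

lemma cip_self: "cip x x = of_real ((norm x)\<^sup>2)"
proof -
  have "Re (cip x x) = (norm x)\<^sup>2"
    by (simp add: inner_eq_Re_cip[symmetric] power2_norm_eq_inner)
  moreover have "Im (cip x x) = 0"
    using cip_commute[of x x] by (metis Reals_cnj_iff complex_is_Real_iff)
  ultimately show ?thesis by (simp add: complex_eq_iff)
qed

lemma cip_add_right: "cip x (y + z) = cip x y + cip x z"
  by (simp add: cip_def sum.distrib algebra_simps)

lemma cip_scale_right: "cip x (c *s y) = c * cip x y"
  by (simp add: cip_def sum_distrib_left mult_ac)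

lemma cip_scaleR_right: "cip x (r *\<^sub>R y) = of_real r * cip x y"
  unfolding cip_def vector_scaleR_component sum_distrib_left
  by (rule sum.cong) (simp_all add: scaleR_conv_of_real)

lemma cip_scaleR_left: "cip (r *\<^sub>R x) y = of_real r * cip x y"
  unfolding cip_def vector_scaleR_component sum_distrib_left
  by (rule sum.cong) (simp_all add: scaleR_conv_of_real)

lemma cip_zero_right [simp]: "cip y 0 = 0"
  by (simp add: cip_def)

section \<open>Trace and Hilbert-Schmidt inner product\<close>

lemma tr_commute: "tr (A ** B) = tr (B ** A)"
proof -
  have "tr (A ** B) = (\<Sum>i\<in>UNIV. \<Sum>j\<in>UNIV. A $ i $ j * B $ j $ i)"
    by (simp add: tr_def matrix_matrix_mult_def)
  also have "\<dots> = (\<Sum>j\<in>UNIV. \<Sum>i\<in>UNIV. A $ i $ j * B $ j $ i)"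
    by (rule sum.swap)
  finally show ?thesis by (simp add: tr_def matrix_matrix_mult_def mult.commute)
qed

lemma tr_sum: "tr (sum f S) = (\<Sum>x\<in>S. tr (f x))"
  by (induction S rule: infinite_finite_induct) (auto simp: tr_def sum.distrib)

lemma tr_one: "tr (mat 1 :: 'n::finite op) = of_nat CARD('n)"
  by (simp add: tr_def mat_def)

lemma hs_inner_expand: "hs_inner X Y = (\<Sum>i\<in>UNIV. \<Sum>j\<in>UNIV. cnj (X $ j $ i) * Y $ j $ i)"
  by (simp add: hs_inner_def tr_def matrix_matrix_mult_def)

lemma inner_eq_Re_hs: "inner X Y = Re (hs_inner X Y)"
proof -
  have "inner X Y = (\<Sum>j\<in>UNIV. \<Sum>i\<in>UNIV. Re (cnj (X $ j $ i) * Y $ j $ i))"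
    by (simp add: inner_vec_def inner_complex_def)
  also have "\<dots> = (\<Sum>i\<in>UNIV. \<Sum>j\<in>UNIV. Re (cnj (X $ j $ i) * Y $ j $ i))"
    by (rule sum.swap)
  finally show ?thesis by (simp add: hs_inner_expand)
qed

lemma hs_inner_self_eq_zero: "hs_inner X X = 0 \<Longrightarrow> X = 0"
  by (metis inner_eq_Re_hs inner_eq_zero_iff zero_complex.sel(1))

lemma hs_inner_diff_right: "hs_inner Z (X - Y) = hs_inner Z X - hs_inner Z Y"
  by (simp add: hs_inner_expand sum_subtractf algebra_simps)

lemma hs_inner_add_right: "hs_inner Z (X + Y) = hs_inner Z X + hs_inner Z Y"
  by (simp add: hs_inner_expand sum.distrib algebra_simps)

lemma hs_inner_cscale_left: "hs_inner (cscale c X) Y = cnj c * hs_inner X Y"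
  by (simp add: hs_inner_def adj_cscale cscale_mult_left tr_def sum_distrib_left)

lemma hs_inner_cscale_right: "hs_inner X (cscale c Y) = c * hs_inner X Y"
  by (simp add: hs_inner_def cscale_mult_right tr_def sum_distrib_left)

lemma hs_inner_mult_left: "hs_inner X (Y ** Z) = hs_inner (adj Y ** X) Z"
  by (simp add: hs_inner_def adj_mult matrix_mul_assoc)

lemma hs_inner_mult_right: "hs_inner X (Y ** Z) = hs_inner (X ** adj Z) Y"
  unfolding hs_inner_def adj_mult adj_adj
  by (metis matrix_mul_assoc tr_commute)

lemma adj_self_mult_eq_zero: "adj X ** X = 0 \<longleftrightarrow> X = 0"
proof
  assume "adj X ** X = 0"
  then have "hs_inner X X = 0" by (simp add: hs_inner_def tr_def)
  then show "X = 0" by (rule hs_inner_self_eq_zero)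
qed simp

section \<open>Subspaces and *-algebras of operators\<close>

lemma csubspace_imp_subspace: "csubspace W \<Longrightarrow> subspace W"
  unfolding csubspace_def subspace_def by (metis cscale_of_real)

lemma csubspace_diff: "csubspace W \<Longrightarrow> X \<in> W \<Longrightarrow> Y \<in> W \<Longrightarrow> X - Y \<in> W"
  by (simp add: csubspace_imp_subspace subspace_diff)

lemma csubspace_sum: "csubspace W \<Longrightarrow> (\<And>x. x \<in> S \<Longrightarrow> f x \<in> W) \<Longrightarrow> sum f S \<in> W"
  by (simp add: csubspace_imp_subspace subspace_sum)

lemma csubspace_add: "csubspace W \<Longrightarrow> X \<in> W \<Longrightarrow> Y \<in> W \<Longrightarrow> X + Y \<in> W"
  by (simp add: csubspace_def)

lemma csubspace_cscale: "csubspace W \<Longrightarrow> X \<in> W \<Longrightarrow> cscale c X \<in> W"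
  by (simp add: csubspace_def)

lemma csubspace_zero: "csubspace W \<Longrightarrow> 0 \<in> W"
  by (simp add: csubspace_def)

lemma csubspace_image_mult:
  assumes "csubspace W"
  shows "csubspace ((\<lambda>X. (A::'n::finite op) ** X ** (B::'n op)) ` W)"
proof -
  have "A ** X ** B + A ** Y ** B \<in> (\<lambda>X. A ** X ** B) ` W" if "X \<in> W" "Y \<in> W" for X Y
    using csubspace_add[OF assms that] by (intro image_eqI[of _ _ "X + Y"]) (simp_all add: mult_distribs)
  moreover have "cscale c (A ** X ** B) \<in> (\<lambda>X. A ** X ** B) ` W" if "X \<in> W" for X c
    using csubspace_cscale[OF assms that]
    by (intro image_eqI[of _ _ "cscale c X"]) (simp_all add: cscale_mult_left cscale_mult_right)
  moreover have "0 \<in> (\<lambda>X. A ** X ** B) ` W"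
    using csubspace_zero[OF assms] by (intro image_eqI[of _ _ 0]) simp_all
  ultimately show ?thesis by (auto simp: csubspace_def)
qed

text \<open>A real orthogonal decomposition suffices: testing against both \<open>Y\<close> and
  \<open>cscale \<i> Y\<close> annihilates the real and the imaginary part of the inner
  product.\<close>

lemma hs_projection_exists:
  assumes "csubspace W"
  shows "\<exists>P\<in>W. \<forall>Y\<in>W. hs_inner Y (X - P) = 0"
proof -
  have S: "subspace W" by (rule csubspace_imp_subspace[OF assms])
  obtain P Z where P: "P \<in> span W" and Z: "\<And>w. w \<in> span W \<Longrightarrow> orthogonal Z w" and X: "X = P + Z"
    using orthogonal_subspace_decomp_exists[of W X] by metis
  have "hs_inner Y Z = 0" if Y: "Y \<in> W" for Y
  proof -
    have r: "Re (hs_inner Y' Z) = 0" if "Y' \<in> W" for Y'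
      using Z[of Y'] that S by (metis inner_eq_Re_hs inner_commute orthogonal_def span_base)
    have "Re (hs_inner (cscale \<i> Y) Z) = 0"
      using csubspace_cscale[OF assms Y] r by blast
    then show ?thesis
      using r[OF Y] by (simp add: hs_inner_cscale_left complex_eq_iff)
  qed
  moreover have "P \<in> W" using P S by (metis span_eq_iff)
  ultimately show ?thesis using X by (auto intro!: bexI[of _ P])
qed

text \<open>Two candidates differ by an element of \<open>W\<close> that is orthogonal to itself, so
  the definite description is legitimate.\<close>

lemma hs_proj_eqI:
  assumes W: "csubspace W" and P: "P \<in> W" and orth: "\<And>Y. Y \<in> W \<Longrightarrow> hs_inner Y (X - P) = 0"
  shows "hs_proj W X = P"
  unfolding hs_proj_def
proof (rule the_equality)
  show "P \<in> W \<and> (\<forall>Y\<in>W. hs_inner Y (X - P) = 0)" using P orth by blast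
  fix Q assume Q: "Q \<in> W \<and> (\<forall>Y\<in>W. hs_inner Y (X - Q) = 0)"
  have d: "P - Q \<in> W" using csubspace_diff[OF W P] Q by blast
  have "hs_inner (P - Q) (P - Q) = hs_inner (P - Q) ((X - Q) - (X - P))" by simp
  also have "\<dots> = 0" using d Q orth by (simp only: hs_inner_diff_right) simp
  finally show "Q = P" using hs_inner_self_eq_zero by force
qed

section \<open>Generated algebras, commutants and inverses inside an algebra\<close>

lemma star_algebraD:
  assumes "star_algebra A"
  shows "csubspace A" "X \<in> A \<Longrightarrow> Y \<in> A \<Longrightarrow> X ** Y \<in> A" "X \<in> A \<Longrightarrow> adj X \<in> A"
  using assms by (auto simp: star_algebra_def)

lemma star_algebra_Inter: "(\<And>A. A \<in> F \<Longrightarrow> star_algebra A) \<Longrightarrow> star_algebra (\<Inter>F)"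
  unfolding star_algebra_def csubspace_def by blast

lemma star_algebra_Int: "star_algebra A \<Longrightarrow> star_algebra B \<Longrightarrow> star_algebra (A \<inter> B)"
  using star_algebra_Inter[of "{A, B}"] by auto

lemma star_algebra_alg: "star_algebra (alg S)"
  unfolding alg_def by (rule star_algebra_Inter) simp

lemma alg_superset: "S \<subseteq> alg S"
  unfolding alg_def by blast

lemma alg_minimal: "star_algebra A \<Longrightarrow> S \<subseteq> A \<Longrightarrow> alg S \<subseteq> A"
  unfolding alg_def by blast

lemma star_algebra_UNIV: "star_algebra UNIV"
  by (simp add: star_algebra_def csubspace_def)

lemma csubspace_commutant: "csubspace (commutant S)"
  by (simp add: csubspace_def commutant_def mult_distribs cscale_mult_left cscale_mult_right)

lemma star_algebra_commutant:
  assumes "\<And>X. X \<in> S \<Longrightarrow> adj X \<in> S"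
  shows "star_algebra (commutant S)"
proof -
  have "X ** Y \<in> commutant S" if "X \<in> commutant S" "Y \<in> commutant S" for X Y
    using that unfolding commutant_def
    by (auto simp: matrix_mul_assoc) (metis matrix_mul_assoc)
  moreover have "adj X \<in> commutant S" if "X \<in> commutant S" for X
    using that assms unfolding commutant_def
    by (auto) (metis adj_adj adj_mult)
  ultimately show ?thesis unfolding star_algebra_def using csubspace_commutant by blast
qed

lemma one_in_commutant: "mat 1 \<in> commutant S"
  by (simp add: commutant_def)

lemma commutantD: "X \<in> commutant S \<Longrightarrow> Y \<in> S \<Longrightarrow> X ** Y = Y ** X"
  by (simp add: commutant_def)

text \<open>For hermitian \<open>T\<close> the commutant of \<open>{T}\<close> is closed under
  adjoints, so commutation passes from the generators to the whole star-algebra, adjoints of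
  generators included.\<close>

lemma alg_commutes_with_hermitian:
  assumes "adj T = T" "\<And>X. X \<in> S \<Longrightarrow> X ** T = T ** X" "X \<in> alg S"
  shows "X ** T = T ** X"
proof -
  have "star_algebra (commutant {T})" using assms(1) by (intro star_algebra_commutant) auto
  moreover have "S \<subseteq> commutant {T}" using assms(2) by (auto simp: commutant_def)
  ultimately have "X \<in> commutant {T}" using alg_minimal assms(3) by blast
  then show ?thesis by (rule commutantD) simp
qed

lemma linear_inj_on_subspace_surj:
  fixes f :: "'a::euclidean_space \<Rightarrow> 'a"
  assumes "linear f" "subspace S" "f ` S \<subseteq> S" "\<And>x. x \<in> S \<Longrightarrow> f x = 0 \<Longrightarrow> x = 0"
  shows "f ` S = S"
proof (rule subspace_dim_equal)
  show "subspace (f ` S)" by (rule linear_subspace_image[OF assms(1,2)])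
  have "inj_on f S"
    using assms linear_injective_on_subspace_0 by blast
  then show "dim S \<le> dim (f ` S)"
    using dim_image_eq[OF assms(1), of S] assms(2) by (metis order_refl span_eq_iff)
qed (use assms in auto)

text \<open>Multiplication by \<open>X\<close> is injective on \<open>A\<close>, hence onto by
  dimension; the preimages of \<open>X\<close> and of the identity are the unit and the inverse.
  Unitality is thus a conclusion, which matters because \<open>alg\<close> does not adjoin a
  unit.\<close>

lemma star_algebra_inverse:
  assumes A: "star_algebra A" and X: "X \<in> A" "invertible X"
  shows "mat 1 \<in> A" "matrix_inv X \<in> A"
proof -
  have "subspace A" using A by (simp add: star_algebraD(1) csubspace_imp_subspace)
  moreover have "Y = 0" if "X ** Y = 0" for Y
  proof -
    have "Y = matrix_inv X ** (X ** Y)"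
      by (simp add: matrix_mul_assoc invertible_inv[OF X(2)])
    then show ?thesis using that by simp
  qed
  ultimately have s: "(\<lambda>Y. X ** Y) ` A = A"
    by (intro linear_inj_on_subspace_surj linear_mult_left) (use A X star_algebraD in auto)
  then obtain Y where Y: "Y \<in> A" "X ** Y = X" using X by (metis imageE)
  have "Y = matrix_inv X ** (X ** Y)" by (simp add: matrix_mul_assoc invertible_inv[OF X(2)])
  then have "Y = mat 1" using Y(2) by (simp add: invertible_inv[OF X(2)])
  then show one: "mat 1 \<in> A" using Y by simp
  then obtain Z where Z: "Z \<in> A" "X ** Z = mat 1" using s by (metis imageE)
  then show "matrix_inv X \<in> A" using matrix_inv_unique by blast
qed

section \<open>Positive definite operators\<close>

lemma posdef_iff: "posdef A \<longleftrightarrow> adj A = A \<and> (\<forall>x. x \<noteq> 0 \<longrightarrow> Re (cip x (A *v x)) > 0)"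
proof -
  have "Im (cip x (A *v x)) = 0" if "adj A = A" for x
    using cip_adj[of x A x] that
    by (metis Reals_cnj_iff cip_commute complex_is_Real_iff)
  then show ?thesis unfolding posdef_def Let_def by (auto simp: cip_def)
qed

lemma posdef_hermitian: "posdef A \<Longrightarrow> adj A = A"
  by (simp add: posdef_iff)

lemma posdef_invertible: "posdef A \<Longrightarrow> invertible A"
  unfolding invertible_iff_ker posdef_iff
  by (metis cip_zero_right less_irrefl zero_complex.sel(1))

lemma posdef_add: "posdef A \<Longrightarrow> posdef B \<Longrightarrow> posdef (A + B)"
  unfolding posdef_iff
  by (simp add: adj_add matrix_vector_mult_add_rdistrib cip_add_right add_pos_pos)

lemma posdef_one: "posdef (mat 1)"
  unfolding posdef_iff by (simp add: cip_self)

lemma posdef_conj: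
  assumes "posdef B" "invertible A"
  shows "posdef (adj A ** B ** A)"
  unfolding posdef_iff
proof (intro conjI allI impI)
  show "adj (adj A ** B ** A) = adj A ** B ** A"
    by (simp add: adj_mult posdef_hermitian[OF assms(1)] matrix_mul_assoc)
  fix x :: "complex^'a" assume "x \<noteq> 0"
  then have "A *v x \<noteq> 0" using assms(2) invertible_iff_ker by blast
  then have "Re (cip (A *v x) (B *v (A *v x))) > 0" using assms(1) by (simp add: posdef_iff)
  also have "cip (A *v x) (B *v (A *v x)) = cip x ((adj A ** B ** A) *v x)"
    using cip_adj[of x "adj A" "B *v (A *v x)"]
    by (simp add: matrix_vector_mul_assoc matrix_mul_assoc)
  finally show "Re (cip x ((adj A ** B ** A) *v x)) > 0" .
qed

lemma adj_matrix_inv: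
  assumes "invertible (A::'n::finite op)"
  shows "adj (matrix_inv A) = matrix_inv (adj A)"
proof -
  have "adj (matrix_inv A ** A) = mat 1" by (simp add: invertible_inv[OF assms])
  then show ?thesis by (metis adj_mult matrix_inv_unique)
qed

lemma invertible_matrix_inv: "invertible (A::'n::finite op) \<Longrightarrow> invertible (matrix_inv A)"
  unfolding invertible_def using invertible_def invertible_inv by blast

lemma posdef_conj_hermitian:
  assumes "posdef B" "invertible A" "adj A = A"
  shows "posdef (A ** B ** A)"
  using posdef_conj[OF assms(1,2)] assms(3) by simp

section \<open>Rayleigh quotients and eigenvectors\<close>

lemma mv_scaleR: "(A::'n::finite op) *v (r *\<^sub>R x) = r *\<^sub>R (A *v x)"
  by (rule linear_scale[OF matrix_vector_mul_linear])

lemma scaleR_mv: "(r *\<^sub>R (A::'n::finite op)) *v x = r *\<^sub>R (A *v x)"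
  unfolding cscale_of_real[symmetric] cscale_mv vec_eq_iff vector_scaleR_component
  by (simp add: scaleR_conv_of_real)

lemma hs_inner_scaleR_right: "hs_inner X (r *\<^sub>R Y) = of_real r * hs_inner X Y"
  by (simp only: hs_inner_cscale_right flip: cscale_of_real)

text \<open>The unit sphere of the range of \<open>p\<close> is compact, and homogeneity extends the
  bound from it to the whole range. Taking the identity for \<open>p\<close> yields lower bounds for
  quadratic forms, a smaller idempotent an eigenvector inside a corner.\<close>

lemma rayleigh_minimum:
  fixes h p :: "'n::finite op"
  assumes p: "p ** p = p" "p \<noteq> 0"
  obtains x where "p *v x = x" "norm x = 1"
    "\<And>y. p *v y = y \<Longrightarrow> Re (cip y (h *v y)) \<ge> Re (cip x (h *v x)) * (norm y)\<^sup>2"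
proof -
  define S where "S = {y. p *v y = y} \<inter> sphere 0 1"
  have "closed {y. p *v y = y}"
    by (intro closed_Collect_eq continuous_intros linear_continuous_on) auto
  then have "compact S"
    unfolding S_def by (intro closed_Int_compact) auto
  moreover have "S \<noteq> {}"
  proof -
    obtain z where "p *v z \<noteq> 0" using p(2) by (metis matrix_eq matrix_vector_mult_0)
    then have "(1 / norm (p *v z)) *\<^sub>R (p *v z) \<in> S"
      by (simp add: S_def mv_scaleR matrix_vector_mul_assoc p(1))
    then show ?thesis by blast
  qed
  moreover have "continuous_on S (\<lambda>y. Re (cip y (h *v y)))"
    unfolding inner_eq_Re_cip[symmetric]
    by (intro continuous_on_inner continuous_on_id linear_continuous_on
        matrix_vector_mul_bounded_linear)
  ultimately obtain x where x: "x \<in> S" "\<And>y. y \<in> S \<Longrightarrow> Re (cip x (h *v x)) \<le> Re (cip y (h *v y))"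
    using continuous_attains_inf[of S "\<lambda>y. Re (cip y (h *v y))"] by blast
  have "Re (cip y (h *v y)) \<ge> Re (cip x (h *v x)) * (norm y)\<^sup>2" if y: "p *v y = y" for y
  proof (cases "y = 0")
    case False
    let ?z = "(1 / norm y) *\<^sub>R y"
    have "?z \<in> S" using False y by (simp add: S_def mv_scaleR)
    from x(2)[OF this] have "Re (cip x (h *v x)) \<le> Re (cip y (h *v y)) / (norm y)\<^sup>2"
      by (simp add: mv_scaleR cip_scaleR_left cip_scaleR_right power2_eq_square
          flip: of_real_mult)
    then show ?thesis using False by (simp add: field_simps)
  qed simp
  then show ?thesis using that[of x] x(1) by (auto simp: S_def)
qed

text \<open>A uniform bound survives limits and convex combinations, whereas strict positivity is
  not a closed condition.\<close>

lemma posdef_lower_bound: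
  assumes "posdef (V::'n::finite op)"
  obtains e where "e > 0" "\<And>y. e * (norm y)\<^sup>2 \<le> Re (cip y (V *v y))"
proof -
  have "mat 1 \<noteq> (0::'n op)" by (simp add: vec_eq_iff mat_def)
  then obtain x where x: "norm (x::complex^'n) = 1"
    "\<And>y. mat 1 *v y = y \<Longrightarrow> Re (cip y (V *v y)) \<ge> Re (cip x (V *v x)) * (norm y)\<^sup>2"
    using rayleigh_minimum[of "mat 1 :: 'n op" V] by auto
  moreover from x have "x \<noteq> 0" by auto
  then have "Re (cip x (V *v x)) > 0" using assms by (simp add: posdef_iff)
  ultimately show ?thesis using that by simp
qed

lemma hermitian_corner_eigenvector:
  fixes h p :: "'n::finite op"
  assumes p: "p ** p = p" "p \<noteq> 0" and h: "adj h = h" "p ** h = h"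
  obtains x \<mu> where "p *v x = x" "x \<noteq> 0" "h *v x = \<mu> *s x"
proof -
  obtain x where x: "p *v x = x" "norm x = 1"
    and min: "\<And>y. p *v y = y \<Longrightarrow> Re (cip y (h *v y)) \<ge> Re (cip x (h *v x)) * (norm y)\<^sup>2"
    using rayleigh_minimum[OF p] by metis
  define m where "m = Re (cip x (h *v x))"
  \<comment> \<open>The residual of the eigenvalue equation. Moving \<open>x\<close> along
    \<open>z\<close> changes \<open>q\<close> at first-order rate
    \<open>2 * (norm z)\<^sup>2\<close>, which minimality forbids unless \<open>z\<close>
    vanishes.\<close>
  define z where "z = h *v x - m *\<^sub>R x"
  have pz: "p *v z = z"
    unfolding z_def by (simp add: matrix_vector_mult_diff_distrib mv_scaleR
        matrix_vector_mul_assoc h x)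
  define q where "q y = Re (cip y (h *v y)) - m * (norm y)\<^sup>2" for y
  have "q (x + t *\<^sub>R z) = 2 * t * (norm z)\<^sup>2 + t\<^sup>2 * q z" for t
  proof -
    have xz: "inner z (h *v x) - m * inner z x = (norm z)\<^sup>2"
      unfolding power2_norm_eq_inner by (simp add: z_def algebra_simps)
    have sym: "inner x (h *v z) = inner z (h *v x)"
      unfolding inner_eq_Re_cip by (metis cip_adj h(1) inner_commute inner_eq_Re_cip)
    have qx: "inner x (h *v x) = m" "inner x x = 1"
      using x(2) by (simp_all add: m_def inner_eq_Re_cip[symmetric] norm_eq_1)
    have "q (x + t *\<^sub>R z) = inner x (h *v x) + t * inner x (h *v z) + t * inner z (h *v x)
        + t\<^sup>2 * inner z (h *v z) - m * (inner x x + 2 * t * inner z x + t\<^sup>2 * inner z z)"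
      unfolding q_def inner_eq_Re_cip[symmetric] power2_norm_eq_inner
      by (simp add: matrix_vector_right_distrib mv_scaleR inner_add_left
          inner_add_right algebra_simps power2_eq_square inner_commute)
    also have "\<dots> = 2 * t * (inner z (h *v x) - m * inner z x) + t\<^sup>2 * (inner z (h *v z) - m * inner z z)"
      by (simp add: sym qx algebra_simps)
    finally show ?thesis
      unfolding xz by (simp add: q_def inner_eq_Re_cip[symmetric] power2_norm_eq_inner)
  qed
  moreover have "q (x + t *\<^sub>R z) \<ge> 0" for t
    using min[of "x + t *\<^sub>R z"] pz x
    by (simp add: q_def m_def matrix_vector_right_distrib mv_scaleR)
  ultimately have nn: "2 * t * (norm z)\<^sup>2 + t\<^sup>2 * q z \<ge> 0" for t by metis
  have "z = 0"
  proof (rule ccontr)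
    assume "z \<noteq> 0"
    then have a: "(norm z)\<^sup>2 > 0" by simp
    \<comment> \<open>For \<open>t = - (norm z)\<^sup>2 / c\<close> the linear term wins: as
      \<open>c\<close> is positive and exceeds \<open>q z\<close>, the factor
      \<open>q z / c - 2\<close> is negative.\<close>
    define c where "c = \<bar>q z\<bar> + 1"
    have c: "c > 0" "q z < c" by (auto simp: c_def)
    have "(norm z)\<^sup>2 * (norm z)\<^sup>2 * (q z / c - 2) / c \<ge> 0"
      using nn[of "- (norm z)\<^sup>2 / c"] c by (simp add: field_simps power2_eq_square)
    moreover have "q z / c - 2 < 0" using c by (simp add: field_simps)
    ultimately show False using a c
      by (metis divide_neg_pos linorder_not_le mult_pos_neg mult_pos_pos)
  qed
  then have "h *v x = of_real m *s x"
    by (simp add: z_def vec_eq_iff) (simp add: scaleR_conv_of_real)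
  then show ?thesis using that x by fastforce
qed

section \<open>Averaging over the unitaries of a *-algebra\<close>

lemma commutes_with_matrix_inv:
  assumes "invertible (a::'n::finite op)" "X ** matrix_inv a = matrix_inv a ** X"
  shows "X ** a = a ** X"
proof -
  have "X ** a = a ** (matrix_inv a ** X) ** a"
    by (simp add: matrix_mul_assoc invertible_inv[OF assms(1)])
  also have "\<dots> = a ** X ** (matrix_inv a ** a)"
    unfolding assms(2)[symmetric] by (simp only: matrix_mul_assoc)
  finally show ?thesis by (simp add: invertible_inv[OF assms(1)])
qed

text \<open>There are enough unitaries: a hermitian element is recovered from its Cayley transform,
  and any element from its hermitian and skew-hermitian parts.\<close>

lemma unitary_commutant:
  fixes M :: "'n::finite op set"
  assumes M: "star_algebra M" "mat 1 \<in> M"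
    and X: "\<And>u. u \<in> M \<Longrightarrow> unitary u \<Longrightarrow> u ** X = X ** u"
  shows "X \<in> commutant M"
proof -
  note sM = star_algebraD[OF M(1)]
  \<comment> \<open>The Cayley transform of a hermitian element is a unitary of the algebra.\<close>
  have herm: "X ** h = h ** X" if h: "h \<in> M" "adj h = h" for h
  proof -
    define a where "a = mat 1 - cscale \<i> h"
    define b where "b = mat 1 + cscale \<i> h"
    have adj_ab: "adj a = b" "adj b = a"
      by (simp_all add: a_def b_def adj_add adj_diff adj_cscale h vec_eq_iff)
    \<comment> \<open>Covers \<open>a\<close> with \<open>c = \<i>\<close> and \<open>b\<close> with
      \<open>c = - \<i>\<close>: the quadratic form of \<open>h\<close> is real, so
      \<open>cip x x\<close> would be imaginary.\<close>
    have ker: "x = 0" if "x = c *s (h *v x)" "Re c = 0" for x c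
    proof -
      have "Im (cip x (h *v x)) = 0"
        using cip_adj[of x h x] h(2) by (metis Reals_cnj_iff cip_commute complex_is_Real_iff)
      moreover have "cip x x = c * cip x (h *v x)" using that(1) cip_scale_right by metis
      ultimately have "Re (cip x x) = 0" using that(2) by simp
      then show "x = 0" by (simp add: cip_self)
    qed
    have inv_a: "invertible a"
      unfolding invertible_iff_ker
      using ker[of _ \<i>] by (simp add: a_def matrix_vector_mult_diff_rdistrib cscale_mv)
    have inv_b: "invertible b"
      unfolding invertible_iff_ker
    proof (intro allI impI)
      fix x assume "b *v x = 0"
      then have "x + \<i> *s (h *v x) = 0"
        by (simp add: b_def matrix_vector_mult_add_rdistrib cscale_mv)
      then have "x = (- \<i>) *s (h *v x)"
        by (simp add: vec_eq_iff add_eq_0_iff2)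
      then show "x = 0" by (rule ker) simp
    qed
    have comm: "a ** b = b ** a"
      by (simp add: a_def b_def mult_distribs)
    have comm': "matrix_inv a ** matrix_inv b = matrix_inv b ** matrix_inv a"
    proof -
      have "(a ** b) ** (matrix_inv b ** matrix_inv a) = a ** (b ** matrix_inv b) ** matrix_inv a"
        by (simp only: matrix_mul_assoc)
      then have 1: "matrix_inv (a ** b) = matrix_inv b ** matrix_inv a"
        by (intro matrix_inv_unique) (simp add: invertible_inv[OF inv_a] invertible_inv[OF inv_b])
      have "(b ** a) ** (matrix_inv a ** matrix_inv b) = b ** (a ** matrix_inv a) ** matrix_inv b"
        by (simp only: matrix_mul_assoc)
      then have "matrix_inv (b ** a) = matrix_inv a ** matrix_inv b"
        by (intro matrix_inv_unique) (simp add: invertible_inv[OF inv_a] invertible_inv[OF inv_b])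
      with 1 show ?thesis by (simp add: comm)
    qed
    have abM: "a \<in> M" "b \<in> M"
      using sM(1) M(2) h(1) by (simp_all add: a_def b_def csubspace_diff csubspace_add csubspace_cscale)
    define u where "u = b ** matrix_inv a"
    have "u \<in> M"
      unfolding u_def using abM sM(2) star_algebra_inverse(2)[OF M(1) _ inv_a] by blast
    moreover have "unitary u"
    proof -
      have "u ** adj u = b ** (matrix_inv a ** matrix_inv b) ** a"
        by (simp only: u_def adj_mult adj_matrix_inv[OF inv_a] adj_ab matrix_mul_assoc)
      also have "\<dots> = (b ** matrix_inv b) ** (matrix_inv a ** a)"
        unfolding comm' by (simp only: matrix_mul_assoc)
      finally have "u ** adj u = mat 1"
        by (simp add: invertible_inv[OF inv_a] invertible_inv[OF inv_b])
      then show ?thesis by (simp add: unitary_def matrix_left_right_inverse)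
    qed
    ultimately have "u ** X = X ** u" by (rule X)
    \<comment> \<open>Being an affine function of the inverse of \<open>a\<close>, \<open>u\<close>
      passes its commutation with \<open>X\<close> on to that inverse, then to \<open>a\<close>,
      then to \<open>h\<close>.\<close>
    moreover have "u = cscale 2 (matrix_inv a) - mat 1"
    proof -
      have "b = cscale 2 (mat 1) - a" by (simp add: a_def b_def vec_eq_iff)
      then show ?thesis
        by (simp add: u_def mult_distribs cscale_mult_left invertible_inv[OF inv_a])
    qed
    ultimately have "cscale 2 (matrix_inv a ** X) = cscale 2 (X ** matrix_inv a)"
      by (simp add: mult_distribs cscale_mult_left cscale_mult_right)
    then have "X ** matrix_inv a = matrix_inv a ** X"
      by (simp add: vec_eq_iff)
    then have "X ** a = a ** X" by (rule commutes_with_matrix_inv[OF inv_a])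
    then have "cscale \<i> (X ** h) = cscale \<i> (h ** X)"
      by (simp add: a_def mult_distribs cscale_mult_left cscale_mult_right)
    then show ?thesis by (simp add: vec_eq_iff)
  qed
  have "X ** Y = Y ** X" if Y: "Y \<in> M" for Y
  proof -
    have "X ** (Y + adj Y) = (Y + adj Y) ** X"
      by (rule herm) (use Y sM in \<open>auto simp: csubspace_add adj_add add.commute\<close>)
    moreover have "X ** cscale \<i> (Y - adj Y) = cscale \<i> (Y - adj Y) ** X"
    proof (rule herm)
      show "cscale \<i> (Y - adj Y) \<in> M" using Y sM by (simp add: csubspace_cscale csubspace_diff)
      show "adj (cscale \<i> (Y - adj Y)) = cscale \<i> (Y - adj Y)"
        by (simp add: vec_eq_iff algebra_simps)
    qed
    then have "X ** (Y - adj Y) = (Y - adj Y) ** X"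
      by (simp add: cscale_mult_left cscale_mult_right) (simp add: vec_eq_iff)
    ultimately have "X ** (Y + adj Y) + X ** (Y - adj Y) = (Y + adj Y) ** X + (Y - adj Y) ** X"
      by simp
    then have "2 *\<^sub>R (X ** Y) = 2 *\<^sub>R (Y ** X)" by (simp add: mult_distribs scaleR_2)
    then show ?thesis by simp
  qed
  then show ?thesis by (simp add: commutant_def)
qed

lemma norm_unitary_conj:
  assumes "unitary u"
  shows "norm (u ** X ** adj u) = norm X"
proof -
  have "hs_inner (u ** X ** adj u) (u ** X ** adj u) = hs_inner (adj u ** (u ** X ** adj u) ** u) X"
    unfolding hs_inner_mult_right[of _ "u ** X"] hs_inner_mult_left[of _ u] by (simp add: matrix_mul_assoc)
  also have "adj u ** (u ** X ** adj u) ** u = (adj u ** u) ** X ** (adj u ** u)"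
    by (simp only: matrix_mul_assoc)
  finally have "hs_inner (u ** X ** adj u) (u ** X ** adj u) = hs_inner X X"
    using assms by (simp add: unitary_def)
  then show ?thesis by (simp add: norm_eq_sqrt_inner inner_eq_Re_hs)
qed

text \<open>The element of least Hilbert-Schmidt norm of an invariant convex set is unique, hence fixed
  by conjugation; this replaces integration over the unitary group of the algebra.\<close>

lemma invariant_convex_meets_commutant:
  assumes M: "star_algebra M" "mat 1 \<in> M"
    and C: "convex C" "closed C" "C \<noteq> {}"
    and inv: "\<And>u X. u \<in> M \<Longrightarrow> unitary u \<Longrightarrow> X \<in> C \<Longrightarrow> u ** X ** adj u \<in> C"
  obtains X where "X \<in> C" "X \<in> commutant M"
proof -
  define X where "X = closest_point C 0"
  have X: "X \<in> C" "\<And>Y. Y \<in> C \<Longrightarrow> norm X \<le> norm Y"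
    using closest_point_exists[OF C(2,3), of 0] by (auto simp: X_def)
  have "u ** X = X ** u" if u: "u \<in> M" "unitary u" for u
  proof -
    have "u ** X ** adj u = X"
      by (rule any_closest_point_unique[OF C(1,2) inv[OF u X(1)] X(1), of 0])
        (use X in \<open>simp_all add: norm_unitary_conj[OF u(2)]\<close>)
    then have "u ** X ** (adj u ** u) = X ** u" by (metis matrix_mul_assoc)
    then show ?thesis using u(2) by (simp add: unitary_def)
  qed
  then show ?thesis using that X(1) unitary_commutant[OF M] by blast
qed

lemma convex_cip_bound:
  "convex {X. \<forall>x. e * (norm x)\<^sup>2 \<le> Re (cip x (X *v x))}"
proof (rule convexI, clarsimp)
  fix X Y :: "'a op" and u v :: real and x :: "complex^'a"
  assume H: "\<forall>x. e * (norm x)\<^sup>2 \<le> Re (cip x (X *v x))" "\<forall>x. e * (norm x)\<^sup>2 \<le> Re (cip x (Y *v x))"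
    "0 \<le> u" "0 \<le> v" "u + v = 1"
  have "e * (norm x)\<^sup>2 = u * (e * (norm x)\<^sup>2) + v * (e * (norm x)\<^sup>2)"
    by (metis H(5) distrib_right mult_1)
  also have "\<dots> \<le> u * Re (cip x (X *v x)) + v * Re (cip x (Y *v x))"
    using H by (intro add_mono mult_left_mono) auto
  also have "\<dots> = Re (cip x ((u *\<^sub>R X + v *\<^sub>R Y) *v x))"
    by (simp add: matrix_vector_mult_add_rdistrib scaleR_mv
        cip_add_right cip_scaleR_right)
  finally show "e * (norm x)\<^sup>2 \<le> Re (cip x ((u *\<^sub>R X + v *\<^sub>R Y) *v x))" .
qed

lemma closed_cip_bound:
  "closed {X::'n::finite op. \<forall>x. e * (norm x)\<^sup>2 \<le> Re (cip x (X *v x))}"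
proof -
  have "linear (\<lambda>X::'n op. Re (cip x (X *v x)))" for x
    by (rule linearI)
      (simp_all add: matrix_vector_mult_add_rdistrib scaleR_mv
        cip_add_right cip_scaleR_right)
  then show ?thesis
    by (intro closed_Collect_all closed_Collect_le continuous_on_const linear_continuous_on)
      (simp add: linear_conv_bounded_linear)
qed

text \<open>With \<open>M = alg VV \<inter> N\<close>, the projection \<open>\<sigma>\<close> of \<open>V\<close> onto the commutant of \<open>M\<close> lies in
  \<open>alg VV \<inter> N\<tau>\<close>. For every \<open>X \<in> alg VV \<inter> N\<tau>\<close> the operator \<open>X V\<^sup>-\<^sup>1\<close> belongs to \<open>M\<close>;
  taking \<open>X = \<sigma>\<close> shows that \<open>\<sigma>\<close> commutes with \<open>V\<close>, and taking \<open>X \<in> VV\<close> that it is central.\<close>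

lemma center_projection:
  fixes VV :: "'n::finite op set"
  assumes N: "star_algebra N" "mat 1 \<in> N" and t: "\<tau> \<in> commutant N" "invertible \<tau>"
    and VV: "VV \<subseteq> (\<lambda>Z. Z ** \<tau>) ` N" and V: "V \<in> VV" "posdef V"
  defines "\<sigma> \<equiv> hs_proj (center (alg VV)) V"
  shows "posdef \<sigma>" "\<sigma> \<in> center (alg VV)" "\<sigma> \<in> (\<lambda>Z. Z ** \<tau>) ` N"
proof -
  define A where "A = alg VV"
  have A: "star_algebra A" "VV \<subseteq> A"
    using star_algebra_alg alg_superset by (auto simp: A_def)
  note sA = star_algebraD[OF A(1)] and sN = star_algebraD[OF N(1)]
  have VA: "V \<in> A" using V A by blast
  have iV: "invertible V" by (rule posdef_invertible[OF V(2)])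
  have A1: "mat 1 \<in> A" "matrix_inv V \<in> A"
    using star_algebra_inverse[OF A(1) VA iV] by auto
  define M where "M = A \<inter> N"
  have M: "star_algebra M" "mat 1 \<in> M"
    using A N A1 by (auto simp: M_def star_algebra_Int)
  note sM = star_algebraD[OF M(1)]
  define W where "W = (\<lambda>Z. Z ** \<tau>) ` N"
  have sW: "csubspace W"
    using csubspace_image_mult[OF sN(1), of "mat 1" \<tau>] by (simp add: W_def)
  obtain e where e: "e > 0" "\<And>y. e * (norm y)\<^sup>2 \<le> Re (cip y (V *v y))"
    using posdef_lower_bound[OF V(2)] by blast
  define Cp where "Cp = {X::'n op. \<forall>x. e * (norm x)\<^sup>2 \<le> Re (cip x (X *v x))}"
  define Ch where "Ch = {X::'n op. \<forall>Y\<in>commutant M. hs_inner Y (X - V) = 0}"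
  \<comment> \<open>Everything needed of the fixed point is imposed as a closed convex condition:
    both memberships, hermiticity, the lower bound that yields positivity, and the pairings with the
    commutant of \<open>M\<close> that identify a projection of \<open>V\<close>.\<close>
  define C where "C = A \<inter> W \<inter> {X. adj X = X} \<inter> Cp \<inter> Ch"
  have lin_hs: "linear (\<lambda>X::'n op. hs_inner Y X)" for Y
    by (rule linearI) (simp_all add: hs_inner_add_right hs_inner_scaleR_right scaleR_conv_of_real[where 'a = complex])
  have sH: "subspace {X::'n op. adj X = X}"
    by (simp add: subspace_def adj_add) (simp add: vec_eq_iff)
  have Ch_alt: "Ch = {X. \<forall>Y. Y \<in> commutant M \<longrightarrow> hs_inner Y X = hs_inner Y V}"
    by (auto simp: Ch_def hs_inner_diff_right)
  have "closed Ch"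
    unfolding Ch_alt
    by (intro closed_Collect_all closed_Collect_imp closed_Collect_eq continuous_on_const
        linear_continuous_on open_Collect_const)
      (use lin_hs in \<open>simp add: linear_conv_bounded_linear\<close>)
  have "closed C"
    unfolding C_def Cp_def
    by (intro closed_Int closed_subspace csubspace_imp_subspace sA(1) sW sH closed_cip_bound \<open>closed Ch\<close>)
  moreover have "convex C"
  proof -
    have "convex Ch"
    proof (rule convexI, unfold Ch_alt, clarsimp)
      fix X Y :: "'n op" and u v :: real and Z
      assume H: "\<forall>Y. Y \<in> commutant M \<longrightarrow> hs_inner Y X = hs_inner Y V"
        "\<forall>Z. Z \<in> commutant M \<longrightarrow> hs_inner Z Y = hs_inner Z V" "u + v = 1" "Z \<in> commutant M"
      then have "hs_inner Z (u *\<^sub>R X + v *\<^sub>R Y) = (of_real u + of_real v) * hs_inner Z V"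
        by (simp add: hs_inner_add_right hs_inner_scaleR_right distrib_right)
      also have "(of_real u + of_real v :: complex) = 1"
        using H(3) by (metis of_real_1 of_real_add)
      finally show "hs_inner Z (u *\<^sub>R X + v *\<^sub>R Y) = hs_inner Z V" by simp
    qed
    moreover have "convex A" "convex W"
      by (intro subspace_imp_convex csubspace_imp_subspace sA(1) sW)+
    ultimately show ?thesis
      unfolding C_def Cp_def
      by (intro convex_Int subspace_imp_convex[OF sH] convex_cip_bound)
  qed
  moreover have "V \<in> C"
  proof -
    have "V \<in> W" using V(1) VV by (auto simp: W_def)
    moreover have "V \<in> Cp" using e(2) by (simp add: Cp_def)
    moreover have "V \<in> Ch" by (simp add: Ch_alt)
    ultimately show ?thesis using VA posdef_hermitian[OF V(2)] by (simp add: C_def)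
  qed
  moreover have "u ** X ** adj u \<in> C" if u: "u \<in> M" "unitary u" and X: "X \<in> C" for u X
  proof -
    have uA: "u \<in> A" "adj u \<in> A" and uN: "u \<in> N" "adj u \<in> N"
      using u(1) sM(3) by (auto simp: M_def)
    have "u ** X ** adj u \<in> A" using uA X sA(2) by (auto simp: C_def)
    \<comment> \<open>This is where \<open>u\<close> has to lie in \<open>N\<close>: \<tau> passes
      \<open>adj u\<close>, so the conjugation acts on the factor in \<open>N\<close> alone.\<close>
    moreover have "u ** X ** adj u \<in> W"
    proof -
      obtain Z where Z: "Z \<in> N" "X = Z ** \<tau>" using X by (auto simp: C_def W_def)
      have "u ** X ** adj u = u ** Z ** (\<tau> ** adj u)" by (simp add: Z matrix_mul_assoc)
      also have "\<dots> = (u ** Z ** adj u) ** \<tau>"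
        unfolding commutantD[OF t(1) uN(2)] by (simp add: matrix_mul_assoc)
      finally show ?thesis unfolding W_def using uN Z(1) sN(2) by blast
    qed
    moreover have "adj (u ** X ** adj u) = u ** X ** adj u"
      using X by (simp add: C_def adj_mult matrix_mul_assoc)
    moreover have "u ** X ** adj u \<in> Cp"
    proof -
      have "e * (norm x)\<^sup>2 \<le> Re (cip x ((u ** X ** adj u) *v x))" for x
      proof -
        have "cip x ((u ** X ** adj u) *v x) = cip (adj u *v x) (X *v (adj u *v x))"
          using cip_adj[of x u "X *v (adj u *v x)"] by (simp add: matrix_vector_mul_assoc matrix_mul_assoc)
        moreover have "cip (adj u *v x) (adj u *v x) = cip x x"
          using cip_adj[of "adj u *v x" "adj u" x] u(2) by (simp add: matrix_vector_mul_assoc unitary_def)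
        then have "(norm (adj u *v x))\<^sup>2 = (norm x)\<^sup>2"
          by (simp only: cip_self of_real_eq_iff)
        ultimately show ?thesis
          using X unfolding C_def Cp_def by (metis (no_types, lifting) Int_iff mem_Collect_eq)
      qed
      then show ?thesis by (simp add: Cp_def)
    qed
    moreover have "u ** X ** adj u \<in> Ch"
      unfolding Ch_alt
    proof (clarify)
      fix Y assume Y: "Y \<in> commutant M"
      have "hs_inner Y (u ** X ** adj u) = hs_inner (adj u ** (Y ** u)) X"
        by (simp add: hs_inner_mult_right[of _ "u ** X"] hs_inner_mult_left[of _ u])
      also have "adj u ** (Y ** u) = (adj u ** u) ** Y"
        unfolding commutantD[OF Y u(1)] by (simp add: matrix_mul_assoc)
      finally show "hs_inner Y (u ** X ** adj u) = hs_inner Y V"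
        using X Y u(2) by (auto simp: C_def Ch_alt unitary_def)
    qed
    ultimately show ?thesis by (simp add: C_def)
  qed
  ultimately obtain s where s: "s \<in> C" "s \<in> commutant M"
    using invariant_convex_meets_commutant[OF M, of C] by blast
  have sA': "s \<in> A" and sW': "s \<in> W" and sh: "adj s = s" using s by (auto simp: C_def)
  have "posdef s"
    unfolding posdef_iff
  proof (intro conjI allI impI sh)
    fix x :: "complex^'n" assume "x \<noteq> 0"
    then have "0 < e * (norm x)\<^sup>2" using e by simp
    also have "\<dots> \<le> Re (cip x (s *v x))" using s(1) by (simp add: C_def Cp_def)
    finally show "0 < Re (cip x (s *v x))" .
  qed
  \<comment> \<open>From \<open>V = Z0 ** \<tau>\<close> follows
    \<open>matrix_inv Z0 = \<tau> ** matrix_inv V\<close>, so the quotient of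
    \<open>Z ** \<tau>\<close> by \<open>V\<close> is \<open>Z ** matrix_inv Z0\<close>.\<close>
  have inM: "X ** matrix_inv V \<in> M" if X: "X \<in> A" "X \<in> W" for X
  proof -
    obtain Z Z0 where Z: "Z \<in> N" "X = Z ** \<tau>" "Z0 \<in> N" "V = Z0 ** \<tau>"
      using X V VV by (auto simp: W_def)
    have "Z0 ** (\<tau> ** matrix_inv V) = mat 1"
      using invertible_inv(1)[OF iV] Z(4) by (simp add: matrix_mul_assoc)
    then have 1: "matrix_inv Z0 = \<tau> ** matrix_inv V" "invertible Z0"
      by (auto simp: matrix_inv_unique invertible_right_inverse)
    then have "\<tau> ** matrix_inv V \<in> N" using star_algebra_inverse(2)[OF N(1) Z(3)] by simp
    then have "Z ** (\<tau> ** matrix_inv V) \<in> N" using Z sN(2) by blast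
    then have "X ** matrix_inv V \<in> N" by (simp add: Z(2) matrix_mul_assoc)
    then show ?thesis using X A1(2) sA(2) by (simp add: M_def)
  qed
  \<comment> \<open>The quotient of \<open>s\<close> itself by \<open>V\<close> lies in
    \<open>M\<close> and so commutes with \<open>s\<close>; cancelling one \<open>s\<close> leaves
    commutation with the inverse of \<open>V\<close>.\<close>
  have sV: "s ** V = V ** s"
  proof -
    have "s ** (s ** matrix_inv V) = (s ** matrix_inv V) ** s"
      using commutantD[OF s(2) inM[OF sA' sW']] .
    then have "s ** (s ** matrix_inv V) = s ** (matrix_inv V ** s)"
      by (simp add: matrix_mul_assoc)
    then have "matrix_inv s ** s ** (s ** matrix_inv V) = matrix_inv s ** s ** (matrix_inv V ** s)"
      by (metis matrix_mul_assoc)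
    then have "s ** matrix_inv V = matrix_inv V ** s"
      by (simp add: invertible_inv[OF posdef_invertible[OF \<open>posdef s\<close>]])
    then show ?thesis by (rule commutes_with_matrix_inv[OF iV])
  qed
  have "X ** s = s ** X" if "X \<in> VV" for X
  proof -
    define Y where "Y = X ** matrix_inv V"
    have Y: "s ** Y = Y ** s"
      using commutantD[OF s(2) inM, of X] that A(2) VV by (auto simp: Y_def W_def)
    have X: "X = Y ** V"
      by (simp add: Y_def matrix_mul_assoc[symmetric] invertible_inv[OF iV])
    have "X ** s = Y ** (s ** V)" by (simp add: X matrix_mul_assoc[symmetric] sV)
    also have "\<dots> = s ** X" by (simp add: X matrix_mul_assoc Y)
    finally show ?thesis .
  qed
  then have sX: "X ** s = s ** X" if "X \<in> A" for X
    by (rule alg_commutes_with_hermitian[OF sh _ that[unfolded A_def]])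
  have "s \<in> commutant A"
    unfolding commutant_def mem_Collect_eq by (intro ballI, rule sym, rule sX)
  then have sc: "s \<in> center A" using sA' by (simp add: center_def)
  \<comment> \<open>The center of \<open>A\<close> lies in the commutant of \<open>M\<close>, so
    \<open>Ch\<close> supplies the orthogonality. As the left-hand side does not mention
    \<open>N\<close> or \<tau>, neither does \<open>s\<close> depend on them.\<close>
  have "hs_proj (center A) V = s"
  proof (rule hs_proj_eqI)
    show "csubspace (center A)"
      using sA(1) csubspace_commutant[of A] by (auto simp: center_def csubspace_def)
    fix Y assume "Y \<in> center A"
    then have "Y \<in> commutant M" unfolding center_def commutant_def M_def by blast
    then show "hs_inner Y (V - s) = 0" using s(1) by (simp add: C_def Ch_alt hs_inner_diff_right)
  qed (fact sc)
  then have "\<sigma> = s" by (simp only: \<sigma>_def A_def)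
  then show "posdef \<sigma>" "\<sigma> \<in> center (alg VV)" "\<sigma> \<in> (\<lambda>Z. Z ** \<tau>) ` N"
    using \<open>posdef s\<close> sc sW' by (simp_all only: A_def W_def)
qed

section \<open>Projections in a *-algebra\<close>

definition projection :: "'n::finite op \<Rightarrow> bool" where
  "projection p \<longleftrightarrow> adj p = p \<and> p ** p = p"

text \<open>Minimality is encoded by a one-dimensional corner, the property that later arguments
  consume; \<open>smaller_projection\<close> relates it to the order of projections.\<close>

definition minproj :: "'n::finite op set \<Rightarrow> 'n op \<Rightarrow> bool" where
  "minproj A p \<longleftrightarrow> p \<in> A \<and> projection p \<and> p \<noteq> 0 \<and> (\<forall>h\<in>A. \<exists>c. p ** h ** p = cscale c p)"

lemma projectionD: "projection p \<Longrightarrow> adj p = p" "projection p \<Longrightarrow> p ** p = p"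
  by (simp_all add: projection_def)

lemma projection_absorb_swap:
  "adj e = e \<Longrightarrow> adj p = p \<Longrightarrow> e ** p = e \<Longrightarrow> p ** e = e"
  by (metis adj_mult)

lemma projection_diff:
  assumes "projection p" "projection e" "e ** p = e"
  shows "projection (p - e)"
  using assms projection_absorb_swap[of e p]
  by (simp add: projection_def adj_diff mult_distribs)

text \<open>The projection of the identity onto a left ideal is a right unit of the ideal.\<close>

lemma left_ideal_projection:
  fixes A :: "'n::finite op set"
  assumes A: "star_algebra A" "mat 1 \<in> A"
    and J: "csubspace J" "J \<subseteq> A" "\<And>X Y. X \<in> A \<Longrightarrow> Y \<in> J \<Longrightarrow> X ** Y \<in> J"
  obtains e where "e \<in> J" "projection e" "\<And>X. X \<in> J \<Longrightarrow> X ** e = X"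
proof -
  note sA = star_algebraD[OF A(1)]
  obtain e where e: "e \<in> J" "\<And>Y. Y \<in> J \<Longrightarrow> hs_inner Y (mat 1 - e) = 0"
    using hs_projection_exists[OF J(1)] by metis
  have unit: "X ** e = X" if X: "X \<in> J" for X
  proof -
    define Y where "Y = X - X ** e"
    have "X ** e \<in> J" using J X e(1) by blast
    then have Y: "Y \<in> J" unfolding Y_def by (rule csubspace_diff[OF J(1) X])
    have "hs_inner Y Y = hs_inner Y (X ** (mat 1 - e))" by (simp add: Y_def mult_distribs)
    also have "\<dots> = hs_inner (adj X ** Y) (mat 1 - e)" by (rule hs_inner_mult_left)
    also have "\<dots> = 0" using e(2) J(2,3) sA(3) X Y by blast
    finally have "Y = 0" by (rule hs_inner_self_eq_zero)
    then show ?thesis by (simp add: Y_def)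
  qed
  \<comment> \<open>So far \<open>e\<close> is only known as a right unit of \<open>J\<close>.
    Vanishing of \<open>D\<close> says \<open>adj e = e ** adj e\<close>, whose right-hand side is
    hermitian.\<close>
  define D where "D = (mat 1 - e) ** adj e"
  have D: "D \<in> A"
    unfolding D_def using sA A(2) J(2) e(1) by (meson csubspace_diff subsetD)
  have "hs_inner D D = hs_inner (D ** e) (mat 1 - e)"
    unfolding D_def[symmetric] by (subst (2) D_def) (simp add: hs_inner_mult_right)
  also have "\<dots> = 0" using e J(3)[OF D e(1)] by blast
  finally have "D = 0" by (rule hs_inner_self_eq_zero)
  then have 1: "e ** adj e = adj e" by (simp add: D_def mult_distribs)
  then have "adj e = e" by (metis adj_adj adj_mult)
  then have "projection e" using 1 by (simp add: projection_def)
  then show ?thesis using that e(1) unit by blast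
qed

text \<open>Subtracting an eigenvalue from a nonscalar hermitian element of the corner gives
  \<open>k\<close>, nonzero but singular on the range of \<open>p\<close>. The elements
  \<open>X\<close> with \<open>X ** p = X\<close> and \<open>X ** k = 0\<close> form a left ideal,
  and \<open>e\<close> is its projection; \<open>e = p\<close> would force
  \<open>k = 0\<close>.\<close>

lemma smaller_projection:
  fixes A :: "'n::finite op set"
  assumes A: "star_algebra A" "mat 1 \<in> A"
    and p: "p \<in> A" "projection p" "p \<noteq> 0" "\<not> minproj A p"
  obtains e where "e \<in> A" "projection e" "e \<noteq> 0" "e \<noteq> p" "e ** p = e"
proof -
  note sA = star_algebraD[OF A(1)] and pp = projectionD[OF p(2)]
  obtain h0 where h0: "h0 \<in> A" "\<And>c. p ** h0 ** p \<noteq> cscale c p"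
    using p by (auto simp: minproj_def)
  define h where "h = p ** h0 ** p"
  have h: "h \<in> A" "p ** h = h" "h ** p = h" "p ** adj h = adj h" "adj h ** p = adj h"
    using h0(1) p(1) sA(2)
    by (auto simp: h_def adj_mult pp matrix_mul_assoc) (simp_all add: matrix_mul_assoc[symmetric] pp)
  \<comment> \<open>If the hermitian and the skew-hermitian part of \<open>h\<close> were both
    multiples of \<open>p\<close>, so would be \<open>h\<close>; the factor \<i> makes the second
    one hermitian.\<close>
  obtain g where g: "g \<in> A" "adj g = g" "p ** g = g" "g ** p = g" "\<And>c. g \<noteq> cscale c p"
  proof (cases "\<exists>c. h + adj h = cscale c p")
    case False
    show ?thesis
      by (rule that[of "h + adj h"])
        (use False h sA in \<open>auto simp: adj_add mult_distribs csubspace_add add.commute\<close>)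
  next
    case True
    then obtain c where c: "h + adj h = cscale c p" by blast
    show ?thesis
    proof (rule that[of "cscale \<i> (h - adj h)"])
      show "cscale \<i> (h - adj h) \<in> A" using h sA by (simp add: csubspace_cscale csubspace_diff)
      show "adj (cscale \<i> (h - adj h)) = cscale \<i> (h - adj h)"
        by (simp add: vec_eq_iff algebra_simps)
      show "p ** cscale \<i> (h - adj h) = cscale \<i> (h - adj h)"
        "cscale \<i> (h - adj h) ** p = cscale \<i> (h - adj h)"
        using h by (simp_all add: mult_distribs cscale_mult_left cscale_mult_right)
      show "cscale \<i> (h - adj h) \<noteq> cscale d p" for d
      proof
        assume "cscale \<i> (h - adj h) = cscale d p"
        then have "cscale (-\<i>) (cscale \<i> (h - adj h)) = cscale (-\<i>) (cscale d p)" by simp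
        then have "h - adj h = cscale (-\<i> * d) p" by simp
        then have "(h + adj h) + (h - adj h) = cscale c p + cscale (-\<i> * d) p" by (simp only: c)
        then have "cscale (1/2) (h + h) = cscale (1/2) (cscale c p + cscale (-\<i> * d) p)" by simp
        then have "h = cscale ((c - \<i> * d) / 2) p"
          by (simp add: vec_eq_iff field_simps)
        then show False using h0(2) by (simp add: h_def)
      qed
    qed
  qed
  obtain x \<mu> where x: "p *v x = x" "x \<noteq> 0" "g *v x = \<mu> *s x"
    using hermitian_corner_eigenvector[OF pp(2) p(3) g(2,3)] by blast
  define k where "k = g - cscale \<mu> p"
  have k: "p ** k = k" "k ** p = k" "k *v x = 0" "k \<noteq> 0"
    using g x by (simp_all add: k_def mult_distribs pp cscale_mult_left cscale_mult_right
        matrix_vector_mult_diff_rdistrib cscale_mv)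
  define J where "J = {X \<in> A. X ** p = X \<and> X ** k = 0}"
  have "csubspace J"
    using sA(1) by (simp add: J_def csubspace_def mult_distribs cscale_mult_left)
  moreover have "X ** Y \<in> J" if "X \<in> A" "Y \<in> J" for X Y
    using that sA(2) by (simp add: J_def matrix_mul_assoc[symmetric])
  moreover have "J \<subseteq> A" by (auto simp: J_def)
  ultimately obtain e where e: "e \<in> J" "projection e" "\<And>X. X \<in> J \<Longrightarrow> X ** e = X"
    using left_ideal_projection[OF A] by metis
  have "e \<noteq> 0"
  proof
    assume "e = 0"
    then have J0: "X = 0" if "X \<in> J" for X using e(3)[OF that] by simp
    \<comment> \<open>Adding the complementary projection to \<open>k\<close> turns the assumed
      triviality of \<open>J\<close> into injectivity of right multiplication by \<open>m\<close>. A
      left inverse of \<open>m\<close> results, although \<open>m\<close> kills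
      \<open>x\<close>.\<close>
    define m where "m = k + (mat 1 - p)"
    have kA: "k \<in> A" "m \<in> A"
      using g(1) p(1) A(2) sA(1)
      by (simp_all add: k_def m_def csubspace_diff csubspace_add csubspace_cscale)
    have "X = 0" if X: "X \<in> A" "X ** m = 0" for X
    proof -
      have "X ** m ** p = X ** k"
        by (simp add: m_def mult_distribs matrix_mul_assoc[symmetric] k pp)
      then have Xk: "X ** k = 0" using X(2) by simp
      then have "X ** p \<in> J"
        using X(1) p(1) sA(2) by (simp add: J_def matrix_mul_assoc[symmetric] pp k)
      then have "X ** p = 0" by (rule J0)
      then show ?thesis using X(2) Xk by (simp add: m_def mult_distribs)
    qed
    then have "(\<lambda>X. X ** m) ` A = A"
      by (intro linear_inj_on_subspace_surj linear_mult_right csubspace_imp_subspace sA(1))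
        (use sA(2) kA in auto)
    then obtain X where "X ** m = mat 1" using A(2) by (metis imageE)
    moreover have "m *v x = 0"
      by (simp add: m_def matrix_vector_mult_add_rdistrib matrix_vector_mult_diff_rdistrib k x)
    ultimately show False using x(2)
      by (metis matrix_vector_mul_assoc matrix_vector_mul_lid matrix_vector_mult_0_right)
  qed
  moreover have "e \<noteq> p" using e(1) k by (auto simp: J_def)
  ultimately show ?thesis using e by (intro that[of e]) (auto simp: J_def)
qed

lemma orthogonal_sum_absorb:
  assumes "finite E" "e \<in> E" "projection e" "\<And>f. f \<in> E \<Longrightarrow> f \<noteq> e \<Longrightarrow> e ** f = 0"
  shows "e ** \<Sum>E = e"
proof -
  have "e ** \<Sum>E = (\<Sum>f\<in>E. e ** f)" using mult_sum_right[of e "\<lambda>f. f" E] by simp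
  also have "\<dots> = (\<Sum>f\<in>E. if f = e then e else 0)"
    by (rule sum.cong) (use assms projectionD in auto)
  finally show ?thesis using assms by simp
qed

definition orth_minprojs :: "'n::finite op set \<Rightarrow> 'n op set \<Rightarrow> bool" where
  "orth_minprojs A E \<longleftrightarrow> finite E \<and> (\<forall>e\<in>E. minproj A e) \<and> (\<forall>e\<in>E. \<forall>f\<in>E. e \<noteq> f \<longrightarrow> e ** f = 0)"

text \<open>Induction on the dimension of the left ideal of all \<open>X\<close> with
  \<open>X ** p = X\<close>. It contains \<open>p\<close>, while the ideal of a proper subprojection
  does not, so the dimension drops for \<open>e\<close> and for \<open>p - e\<close> alike.\<close>

lemma projection_decomposition:
  fixes A :: "'n::finite op set"
  assumes A: "star_algebra A" "mat 1 \<in> A"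
  shows "p \<in> A \<Longrightarrow> projection p \<Longrightarrow> \<exists>E. orth_minprojs A E \<and> \<Sum>E = p"
proof (induction "dim {X \<in> A. X ** p = X}" arbitrary: p rule: less_induct)
  case less
  note sA = star_algebraD[OF A(1)]
  define L where "L q = {X \<in> A. X ** q = X}" for q
  have dimL: "dim (L q) < dim (L p)" if q: "q \<in> A" "projection q" "q ** p = q" "q \<noteq> p" for q
  proof -
    have sub: "subspace (L r)" for r
      by (rule csubspace_imp_subspace)
        (use sA(1) in \<open>simp add: L_def csubspace_def mult_distribs cscale_mult_left\<close>)
    have le: "L q \<subseteq> L p"
      using q(3) by (auto simp: L_def) (metis matrix_mul_assoc)
    have "p ** q = q"
      using less.prems(2) q(2,3) by (intro projection_absorb_swap projectionD)
    then have "p \<in> L p" "p \<notin> L q"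
      using less.prems q(4) projectionD by (auto simp: L_def)
    then have "L q \<noteq> L p" by blast
    then show ?thesis using subspace_dim_equal[OF sub sub le] by linarith
  qed
  show ?case
  proof (cases "p = 0 \<or> minproj A p")
    case True
    then show ?thesis
    proof
      assume "p = 0"
      then show ?thesis by (intro exI[of _ "{}"]) (simp add: orth_minprojs_def)
    next
      assume "minproj A p"
      then show ?thesis by (intro exI[of _ "{p}"]) (simp add: orth_minprojs_def)
    qed
  next
    case False
    then obtain e where e: "e \<in> A" "projection e" "e \<noteq> 0" "e \<noteq> p" "e ** p = e"
      using smaller_projection[OF A less.prems] by blast
    define d where "d = p - e"
    have d: "d \<in> A" "projection d" "d ** p = d" "d \<noteq> p" "e ** d = 0"
      using e less.prems projection_diff[OF less.prems(2) e(2,5)] csubspace_diff[OF sA(1)]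
      by (auto simp: d_def mult_distribs projectionD)
    obtain E where E: "orth_minprojs A E" "\<Sum>E = e"
      using less.hyps[of e] dimL[of e] e by (auto simp: L_def)
    obtain D where D: "orth_minprojs A D" "\<Sum>D = d"
      using less.hyps[of d] dimL[of d] d by (auto simp: L_def)
    \<comment> \<open>Members of \<open>E\<close> lie below \<open>e\<close>, members of
      \<open>D\<close> below \<open>d\<close>, and \<open>e ** d = 0\<close>.\<close>
    have cross: "f ** g = 0 \<and> g ** f = 0" if f: "f \<in> E" and g: "g \<in> D" for f g
    proof -
      have pf: "projection f" "projection g" using f g E D by (auto simp: orth_minprojs_def minproj_def)
      have "f ** e = f"
        using orthogonal_sum_absorb[of E f] E f pf by (auto simp: orth_minprojs_def)
      moreover have "g ** d = g"
        using orthogonal_sum_absorb[of D g] D g pf by (auto simp: orth_minprojs_def)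
      then have "d ** g = g" using pf d(2) projection_absorb_swap projectionD by blast
      ultimately have "f ** g = f ** (e ** d) ** g" by (metis matrix_mul_assoc)
      then have "f ** g = 0" using d(5) by simp
      moreover from this have "g ** f = 0" by (metis adj_mult adj_zero pf projectionD(1))
      ultimately show ?thesis by blast
    qed
    have "E \<inter> D = {}"
    proof (rule ccontr)
      assume "E \<inter> D \<noteq> {}"
      then obtain f where "f \<in> E" "f \<in> D" by blast
      moreover from this have "f ** f = f" "f \<noteq> 0"
        using E by (auto simp: orth_minprojs_def minproj_def projection_def)
      ultimately show False using cross by metis
    qed
    then have "\<Sum>(E \<union> D) = p"
      using E D by (subst sum.union_disjoint) (auto simp: orth_minprojs_def d_def)
    moreover have "orth_minprojs A (E \<union> D)"
      using E(1) D(1) cross unfolding orth_minprojs_def by blast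
    ultimately show ?thesis by blast
  qed
qed

lemma identity_decomposition:
  assumes "star_algebra A" "mat 1 \<in> A"
  obtains E where "orth_minprojs A E" "\<Sum>E = mat 1"
  using projection_decomposition[OF assms assms(2)] by (auto simp: projection_def)

lemma minprojD:
  assumes "minproj A e"
  shows "e \<in> A" "adj e = e" "e ** e = e" "e \<noteq> 0" "h \<in> A \<Longrightarrow> \<exists>c. e ** h ** e = cscale c e"
  using assms by (auto simp: minproj_def projection_def)

section \<open>Square roots\<close>

text \<open>All elements of the algebra generated by \<rho> and the identity commute with \<rho>, so
  a minimal projection \<open>e\<close> of it satisfies
  \<open>\<rho> ** e = e ** \<rho> ** e\<close>, a multiple of \<open>e\<close>: a resolution of the
  identity by eigenprojections. The membership clause later places roots in an algebra or in its
  commutant.\<close>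

lemma posdef_sqrt_exists:
  fixes \<rho> :: "'n::finite op"
  assumes "posdef \<rho>"
  shows "\<exists>q. posdef q \<and> q ** q = \<rho> \<and> (\<forall>A. star_algebra A \<longrightarrow> mat 1 \<in> A \<longrightarrow> \<rho> \<in> A \<longrightarrow> q \<in> A)"
proof -
  define B where "B = alg {\<rho>, mat 1}"
  have B: "star_algebra B" "mat 1 \<in> B" "\<rho> \<in> B"
    using alg_superset[of "{\<rho>, mat 1}"] by (auto simp: B_def star_algebra_alg)
  have comm: "X ** \<rho> = \<rho> ** X" if "X \<in> B" for X
    by (rule alg_commutes_with_hermitian[OF posdef_hermitian[OF assms] _ that[unfolded B_def]]) auto
  obtain E where E: "orth_minprojs B E" "\<Sum>E = mat 1"
    using identity_decomposition[OF B(1,2)] by blast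
  have fin: "finite E" and orth: "\<And>e f. e \<in> E \<Longrightarrow> f \<in> E \<Longrightarrow> e \<noteq> f \<Longrightarrow> e ** f = 0"
    and min: "\<And>e. e \<in> E \<Longrightarrow> minproj B e"
    using E(1) by (auto simp: orth_minprojs_def)
  have eig: "\<exists>c>0. \<rho> ** e = c *\<^sub>R e" if e: "e \<in> E" for e
  proof -
    note m = minprojD[OF min[OF e]]
    obtain c where "e ** \<rho> ** e = cscale c e" using m(5)[OF B(3)] by blast
    then have c: "\<rho> ** e = cscale c e"
      using comm[OF m(1)] m(3) by (metis matrix_mul_assoc)
    obtain z where z: "e *v z \<noteq> 0" using m(4) by (metis matrix_eq matrix_vector_mult_0)
    define x where "x = e *v z"
    have "\<rho> *v x = c *s x"
      by (simp add: x_def matrix_vector_mul_assoc c cscale_mv)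
    then have cx: "cip x (\<rho> *v x) = c * cip x x" by (simp add: cip_scale_right)
    have "Im (cip x (\<rho> *v x)) = 0"
      using cip_adj[of x \<rho> x] posdef_hermitian[OF assms]
      by (metis Reals_cnj_iff cip_commute complex_is_Real_iff)
    moreover have "Re (cip x (\<rho> *v x)) > 0" using assms z by (simp add: posdef_iff x_def)
    ultimately have "Re c > 0" "Im c = 0"
      using z unfolding cx cip_self x_def[symmetric] by (auto simp: zero_less_mult_iff)
    then have "c = of_real (Re c)" by (simp add: complex_eq_iff)
    then have "cscale c e = Re c *\<^sub>R e" by (metis cscale_of_real)
    then show ?thesis using c \<open>Re c > 0\<close> by auto
  qed
  then obtain c where c: "\<And>e. e \<in> E \<Longrightarrow> c e > 0" "\<And>e. e \<in> E \<Longrightarrow> \<rho> ** e = c e *\<^sub>R e" by metis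
  define q where "q = (\<Sum>e\<in>E. sqrt (c e) *\<^sub>R e)"
  have qe: "q ** e = sqrt (c e) *\<^sub>R e" if e: "e \<in> E" for e
  proof -
    have "q ** e = (\<Sum>f\<in>E. sqrt (c f) *\<^sub>R (f ** e))"
      by (simp add: q_def mult_sum_left mult_scaleR_left)
    also have "\<dots> = (\<Sum>f\<in>E. if f = e then sqrt (c e) *\<^sub>R e else 0)"
      by (rule sum.cong) (use orth e minprojD(3)[OF min[OF e]] in auto)
    finally show ?thesis using fin e by simp
  qed
  have expand: "X = (\<Sum>e\<in>E. X ** e)" for X :: "'n op"
    using mult_sum_right[of X "\<lambda>e. e" E] E(2) by simp
  have "q ** q = \<rho>"
  proof -
    have "q ** q ** e = \<rho> ** e" if "e \<in> E" for e
      using that c(1)[OF that]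
      by (simp add: matrix_mul_assoc[symmetric] qe mult_scaleR_right c(2))
    then show ?thesis using expand[of "q ** q"] expand[of \<rho>] by simp
  qed
  moreover have "posdef q"
    unfolding posdef_iff
  proof (intro conjI allI impI)
    show "adj q = q"
      unfolding q_def adj_sum
      by (rule sum.cong) (simp_all add: adj_cscale minprojD(2)[OF min] flip: cscale_of_real)
    fix x :: "complex^'n" assume x: "x \<noteq> 0"
    have mv_sum: "sum g E *v x = (\<Sum>e\<in>E. g e *v x)" for g :: "'n op \<Rightarrow> 'n op"
      using fin by (induction E) (auto simp: matrix_vector_mult_add_rdistrib)
    have cip_sum: "cip x (sum g E) = (\<Sum>e\<in>E. cip x (g e))" for g
      using fin by (induction E) (auto simp: cip_add_right)
    have summand: "Re (cip x ((sqrt (c e) *\<^sub>R e) *v x)) = sqrt (c e) * (norm (e *v x))\<^sup>2" if "e \<in> E" for e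
    proof -
      note m = minprojD[OF min[OF that]]
      have "cip x (e *v x) = cip x (e *v (e *v x))" by (simp add: matrix_vector_mul_assoc m(3))
      also have "\<dots> = cip (e *v x) (e *v x)" using cip_adj[of x e] m(2) by simp
      finally show ?thesis by (simp add: scaleR_mv cip_scaleR_right cip_self)
    qed
    have "\<exists>e\<in>E. e *v x \<noteq> 0"
    proof (rule ccontr)
      assume "\<not> ?thesis"
      then have "\<Sum>E *v x = 0" using mv_sum[of "\<lambda>e. e"] by simp
      then show False using x E(2) by simp
    qed
    then obtain e where "e \<in> E" "e *v x \<noteq> 0" by blast
    then have "0 < (\<Sum>e\<in>E. sqrt (c e) * (norm (e *v x))\<^sup>2)"
      using fin c(1) by (intro sum_pos2[of E e]) (auto simp: less_imp_le)
    also have "\<dots> = Re (cip x (q *v x))"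
      unfolding q_def mv_sum cip_sum Re_sum by (rule sum.cong) (simp_all add: summand)
    finally show "Re (cip x (q *v x)) > 0" .
  qed
  moreover have "q \<in> A" if A: "star_algebra A" "mat 1 \<in> A" "\<rho> \<in> A" for A
  proof -
    have "B \<subseteq> A" unfolding B_def by (rule alg_minimal) (use A in auto)
    moreover have "q \<in> B"
      unfolding q_def cscale_of_real[symmetric]
      by (intro csubspace_sum csubspace_cscale star_algebraD(1) B) (use min minprojD in blast)
    ultimately show ?thesis by blast
  qed
  ultimately show ?thesis by blast
qed

lemma star_algebra_commutant_hermitian: "adj T = T \<Longrightarrow> star_algebra (commutant {T})"
  by (rule star_algebra_commutant) auto

text \<open>The constructed root \<open>q\<close> lies in the commutant of any other root
  \<open>c\<close>, because \<open>c\<close> commutes with its square. Then \<open>q + c\<close>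
  times \<open>q - c\<close> vanishes, and \<open>q + c\<close> is invertible.\<close>

lemma posdef_sqrt_unique:
  assumes "posdef a" "posdef b" "a ** a = b ** b"
  shows "a = b"
proof -
  have p: "posdef (a ** a)"
    using posdef_conj_hermitian[OF posdef_one posdef_invertible[OF assms(1)] posdef_hermitian[OF assms(1)]]
    by simp
  obtain q where q: "posdef q" "q ** q = a ** a"
    and A: "\<And>A. star_algebra A \<Longrightarrow> mat 1 \<in> A \<Longrightarrow> a ** a \<in> A \<Longrightarrow> q \<in> A"
    using posdef_sqrt_exists[OF p] by blast
  have eq: "q = c" if c: "posdef c" "c ** c = a ** a" for c
  proof -
    have "q \<in> commutant {c}"
      by (rule A) (use star_algebra_commutant_hermitian[OF posdef_hermitian[OF c(1)]] in
          \<open>simp_all add: one_in_commutant c(2)[symmetric] commutant_def matrix_mul_assoc\<close>)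
    then have "q ** c = c ** q" by (simp add: commutant_def)
    then have "(q + c) ** (q - c) = 0"
      by (simp add: mult_distribs q(2) c(2))
    then have "(matrix_inv (q + c) ** (q + c)) ** (q - c) = 0"
      by (metis matrix_mul_assoc mult_zero_right)
    then show ?thesis
      by (simp add: invertible_inv[OF posdef_invertible[OF posdef_add[OF q(1) c(1)]]])
  qed
  have "q = a" "q = b" by (rule eq[OF assms(1) refl], rule eq[OF assms(2) assms(3)[symmetric]])
  then show ?thesis by simp
qed

lemma psqrt_eqI: "posdef q \<Longrightarrow> q ** q = \<rho> \<Longrightarrow> psqrt \<rho> = q"
  unfolding psqrt_def by (rule the_equality) (auto intro: posdef_sqrt_unique)

lemma psqrt:
  assumes "posdef \<rho>"
  shows "posdef (psqrt \<rho>)" "psqrt \<rho> ** psqrt \<rho> = \<rho>"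
    "star_algebra A \<Longrightarrow> mat 1 \<in> A \<Longrightarrow> \<rho> \<in> A \<Longrightarrow> psqrt \<rho> \<in> A"
proof -
  obtain q where q: "posdef q" "q ** q = \<rho>"
    "\<And>A. star_algebra A \<Longrightarrow> mat 1 \<in> A \<Longrightarrow> \<rho> \<in> A \<Longrightarrow> q \<in> A"
    using posdef_sqrt_exists[OF assms] by blast
  have "psqrt \<rho> = q" by (rule psqrt_eqI[OF q(1,2)])
  then show "posdef (psqrt \<rho>)" "psqrt \<rho> ** psqrt \<rho> = \<rho>"
    "star_algebra A \<Longrightarrow> mat 1 \<in> A \<Longrightarrow> \<rho> \<in> A \<Longrightarrow> psqrt \<rho> \<in> A"
    using q by simp_all
qed

text \<open>The root of \<open>a\<close> also commutes with \<open>b\<close>, so the product is the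
  congruence \<open>psqrt a ** b ** psqrt a\<close>.\<close>

lemma posdef_mult_commuting:
  assumes "posdef a" "posdef b" "a ** b = b ** a"
  shows "posdef (a ** b)"
proof -
  have "psqrt a \<in> commutant {b}"
    by (rule psqrt(3)[OF assms(1)])
      (use star_algebra_commutant_hermitian[OF posdef_hermitian[OF assms(2)]] assms(3) in
        \<open>simp_all add: one_in_commutant commutant_def\<close>)
  then have "psqrt a ** b = b ** psqrt a" by (simp add: commutant_def)
  then have "psqrt a ** b ** psqrt a = psqrt a ** (psqrt a ** b)"
    by (metis matrix_mul_assoc)
  also have "\<dots> = a ** b" by (simp add: matrix_mul_assoc psqrt(2)[OF assms(1)])
  finally show ?thesis
    using posdef_conj_hermitian[OF assms(2) posdef_invertible posdef_hermitian] psqrt(1)[OF assms(1)]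
    by metis
qed

section \<open>The Wedderburn decomposition\<close>

subsection \<open>Rank-one operators\<close>

text \<open>The operator written |x><y| in bra-ket notation.\<close>

definition outer :: "complex^'n::finite \<Rightarrow> complex^'n \<Rightarrow> 'n op" where
  "outer x y = (\<chi> i j. x $ i * cnj (y $ j))"

lemma mult_outer: "M ** outer x y = outer (M *v x) y"
  by (simp add: vec_eq_iff outer_def matrix_matrix_mult_def matrix_vector_mult_def
      sum_distrib_right mult.assoc)

lemma adj_outer: "adj (outer x y) = outer y x"
  by (simp add: vec_eq_iff outer_def mult.commute)

lemma outer_mult: "outer x y ** M = outer x (adj M *v y)"
proof -
  have "adj (adj (outer x y ** M)) = outer x (adj M *v y)"
    by (subst adj_mult) (simp add: adj_outer mult_outer)
  then show ?thesis by simp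
qed

lemma outer_mult_outer: "outer x y ** outer z w = cscale (cip y z) (outer x w)"
  by (simp add: vec_eq_iff outer_def matrix_matrix_mult_def cip_def sum_distrib_left
      sum_distrib_right mult_ac)

lemma tr_outer: "tr (outer x y) = cip y x"
  by (simp add: tr_def outer_def cip_def mult.commute)

text \<open>For a unit vector \<open>x\<close> in the range, \<open>outer x x\<close> lies in the
  one-dimensional corner of \<open>p\<close>; idempotency forces the proportionality factor to be
  1.\<close>

lemma rank_one_minproj:
  assumes "minproj UNIV p"
  shows "\<exists>x. p = outer x x \<and> cip x x = 1"
proof -
  note m = minprojD[OF assms]
  obtain z where z: "p *v z \<noteq> 0" using m(4) by (metis matrix_eq matrix_vector_mult_0)
  define x where "x = (1 / norm (p *v z)) *\<^sub>R (p *v z)"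
  have px: "p *v x = x" by (simp add: x_def mv_scaleR matrix_vector_mul_assoc m(3))
  have "norm x = 1" using z by (simp add: x_def)
  then have xx: "cip x x = 1" by (simp add: cip_self)
  have "p ** outer x x ** p = outer x x" by (simp add: mult_outer outer_mult px m(2))
  then obtain c where c: "outer x x = cscale c p" using m(5)[of "outer x x"] by auto
  have "outer x x \<noteq> 0" using xx tr_outer[of x x] by (auto simp: tr_def)
  then have "c \<noteq> 0" using c by auto
  have "outer x x ** outer x x = outer x x" by (simp add: outer_mult_outer xx)
  then have "cscale (c * c) p = cscale c p" by (simp add: c cscale_mult_left cscale_mult_right m(3))
  then have "cscale (c * c - c) p = 0" by (simp add: vec_eq_iff algebra_simps)
  then have "c = 1" using m(4) \<open>c \<noteq> 0\<close> by (simp add: cscale_eq_zero_iff)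
  then show ?thesis using c xx by auto
qed

subsection \<open>Equivalence of minimal projections\<close>

text \<open>Murray-von Neumann equivalence inside \<open>A\<close>: \<open>v\<close> is a partial
  isometry with initial projection \<open>f\<close> and final projection \<open>e\<close>.\<close>

definition iso_proj :: "'n::finite op set \<Rightarrow> 'n op \<Rightarrow> 'n op \<Rightarrow> bool" where
  "iso_proj A e f \<longleftrightarrow> (\<exists>v\<in>A. adj v ** v = f \<and> v ** adj v = e)"

lemma partial_isometry_absorb:
  assumes "adj v ** v = f" "f ** f = f"
  shows "v ** f = v"
proof -
  have af: "adj f = f" using assms(1) by (metis adj_adj adj_mult)
  have "adj (v - v ** f) ** (v - v ** f)
      = adj v ** v - adj v ** v ** f - f ** (adj v ** v) + f ** (adj v ** v) ** f"
    by (simp add: adj_diff adj_mult mult_distribs matrix_mul_assoc af)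
  also have "\<dots> = 0" by (simp add: assms)
  finally show ?thesis by (simp add: adj_self_mult_eq_zero)
qed

lemma iso_proj_sym: "star_algebra A \<Longrightarrow> iso_proj A e f \<Longrightarrow> iso_proj A f e"
  unfolding iso_proj_def by (metis adj_adj star_algebraD(3))

lemma iso_proj_trans:
  assumes A: "star_algebra A" and ef: "iso_proj A e f" and fg: "iso_proj A f g" and f: "f ** f = f"
  shows "iso_proj A e g"
proof -
  obtain v where v: "v \<in> A" "adj v ** v = f" "v ** adj v = e" using ef by (auto simp: iso_proj_def)
  obtain w where w: "w \<in> A" "adj w ** w = g" "w ** adj w = f" using fg by (auto simp: iso_proj_def)
  have 1: "v ** f = v" by (rule partial_isometry_absorb[OF v(2) f])
  have 2: "adj w ** f = adj w" by (rule partial_isometry_absorb) (simp_all add: w f)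
  have "adj (v ** w) ** (v ** w) = adj w ** (adj v ** v) ** w"
    by (simp only: adj_mult matrix_mul_assoc)
  also have "\<dots> = g" by (simp add: v 2 w)
  moreover have "(v ** w) ** adj (v ** w) = v ** (w ** adj w) ** adj v"
    by (simp only: adj_mult matrix_mul_assoc)
  then have "(v ** w) ** adj (v ** w) = e" by (simp add: v 1 w)
  moreover have "v ** w \<in> A" using star_algebraD(2)[OF A] v w by blast
  ultimately show ?thesis unfolding iso_proj_def by metis
qed

lemma hs_inner_self: "hs_inner X X = of_real ((norm X)\<^sup>2)"
proof -
  have "cnj (hs_inner X X) = hs_inner X X" by (simp add: hs_inner_expand mult.commute)
  then have "Im (hs_inner X X) = 0" by (metis Reals_cnj_iff complex_is_Real_iff)
  then show ?thesis
    by (simp add: complex_eq_iff power2_norm_eq_inner inner_eq_Re_hs)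
qed

text \<open>A form of Schur's lemma: for \<open>w\<close> in the corner between \<open>e\<close> and
  \<open>f\<close>, minimality makes \<open>adj w ** w\<close> a multiple of \<open>f\<close>.
  Comparing traces shows the factor to be positive, and rescaling \<open>w\<close> gives the partial
  isometry.\<close>

lemma minproj_partial_isometry:
  assumes A: "star_algebra A" and e: "minproj A e" and f: "minproj A f"
    and h: "h \<in> A" "e ** h ** f \<noteq> 0"
  shows "iso_proj A e f"
proof -
  note sA = star_algebraD[OF A] and me = minprojD[OF e] and mf = minprojD[OF f]
  define w where "w = e ** h ** f"
  have wA: "w \<in> A" using h sA me mf by (simp add: w_def)
  have ew: "e ** w = w" by (simp add: w_def matrix_mul_assoc me)
  have wf: "w ** f = w" by (simp add: w_def matrix_mul_assoc[symmetric] mf)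
  obtain c where "f ** (adj w ** w) ** f = cscale c f"
    using mf(5) wA sA by blast
  moreover have "f ** adj w = adj w" using wf mf(2) by (metis adj_mult)
  ultimately have c: "adj w ** w = cscale c f"
    using wf by (metis matrix_mul_assoc)
  have "hs_inner w w = c * hs_inner f f"
    unfolding hs_inner_def c mf(2,3) by (simp add: tr_def sum_distrib_left)
  then have "of_real ((norm w)\<^sup>2) = c * of_real ((norm f)\<^sup>2)" by (simp only: hs_inner_self)
  then have cr: "c = of_real ((norm w)\<^sup>2 / (norm f)\<^sup>2)"
    using mf(4) by (simp add: field_simps)
  define r where "r = norm f / norm w"
  have "w \<noteq> 0" using h by (simp add: w_def)
  have rc: "of_real (r * r) * c = 1"
    using \<open>w \<noteq> 0\<close> mf(4) by (simp add: cr r_def power2_eq_square)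
  define v where "v = cscale (of_real r) w"
  have vA: "v \<in> A" using wA sA by (simp add: v_def csubspace_cscale)
  have "adj v ** v = cscale (of_real (r * r) * c) f"
    by (simp add: v_def adj_cscale cscale_mult_left cscale_mult_right c mult.assoc)
  then have vv: "adj v ** v = f" by (simp only: rc cscale_one)
  have "v \<noteq> 0" using vv mf(4) by auto
  have vf: "v ** f = v" by (rule partial_isometry_absorb[OF vv mf(3)])
  have ev: "e ** v = v" by (simp add: v_def cscale_mult_right ew)
  obtain d where "e ** (v ** adj v) ** e = cscale d e"
    using me(5) vA sA by blast
  moreover have "adj v ** e = adj v" using ev me(2) by (metis adj_mult)
  ultimately have d: "v ** adj v = cscale d e"
    using ev by (metis matrix_mul_assoc)
  have "(v ** adj v) ** (v ** adj v) = v ** (adj v ** v) ** adj v" by (simp only: matrix_mul_assoc)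
  also have "\<dots> = v ** adj v" by (simp only: vv vf)
  finally have "cscale (d * d) e = cscale d e"
    by (simp add: d cscale_mult_left cscale_mult_right me(3))
  then have "cscale (d * d - d) e = 0" by (simp add: vec_eq_iff algebra_simps)
  moreover have "d \<noteq> 0"
    using d \<open>v \<noteq> 0\<close> adj_self_mult_eq_zero[of "adj v"] by auto
  ultimately have "d = 1" using me(4) by (simp add: cscale_eq_zero_iff)
  then have "v ** adj v = e" using d by simp
  then show ?thesis using vA vv by (auto simp: iso_proj_def)
qed

subsection \<open>Existence\<close>

lemma sum_single:
  assumes "finite S" "k \<in> S" "\<And>i. i \<in> S \<Longrightarrow> i \<noteq> k \<Longrightarrow> h i = 0"
  shows "sum h S = h k"
proof -
  have "sum h S = sum h {k}" by (rule sum.mono_neutral_right) (use assms in auto)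
  then show ?thesis by simp
qed

text \<open>With the vectors \<open>u j\<close> as columns, conjugation becomes a sum of rank-one
  operators, which can be regrouped over any index set in bijection with the coordinates.\<close>

lemma conj_by_columns:
  "(\<chi> i j. u j $ i) ** M ** adj (\<chi> i j. u j $ i)
    = (\<Sum>i\<in>UNIV. \<Sum>j\<in>UNIV. cscale (M $ i $ j) (outer (u i) (u j)))"
proof -
  have "((\<chi> i j. u j $ i) ** M ** adj (\<chi> i j. u j $ i)) $ a $ b
      = (\<Sum>j\<in>UNIV. \<Sum>i\<in>UNIV. M $ i $ j * (u i $ a * cnj (u j $ b)))" for a b
    by (simp add: matrix_matrix_mult_def sum_distrib_left sum_distrib_right mult_ac)
  also have "\<dots> a b = (\<Sum>i\<in>UNIV. \<Sum>j\<in>UNIV. M $ i $ j * (u i $ a * cnj (u j $ b)))" for a b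
    by (rule sum.swap)
  finally show ?thesis by (simp add: vec_eq_iff outer_def)
qed

text \<open>The labels \<open>l\<close>, \<open>s\<close>, \<open>f\<close> number the classes of minimal projections \<open>e \<in> E\<close>, the members of
  a class, and the rank-one projections below the representative of the class; the basis vector
  is the image of a unit vector under the partial isometry from \<open>rep e\<close> to \<open>e\<close>.\<close>

theorem wedderburn_exists:
  fixes A :: "'n::finite op set"
  assumes A: "star_algebra A" "mat 1 \<in> A"
  shows "\<exists>U L dS dF lab. wedderburn A U L dS dF lab"
proof -
  note sA = star_algebraD[OF A(1)]
  obtain E where E: "orth_minprojs A E" "\<Sum>E = mat 1" using identity_decomposition[OF A] .
  have fin: "finite E" and min: "\<And>e. e \<in> E \<Longrightarrow> minproj A e"
    using E(1) by (auto simp: orth_minprojs_def)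
  \<comment> \<open>Equivalent projections satisfy the same predicate under \<open>SOME\<close>, so
    \<open>rep\<close> is constant on classes.\<close>
  define rep where "rep e = (SOME r. r \<in> E \<and> iso_proj A e r)" for e
  have rep: "rep e \<in> E" "iso_proj A e (rep e)" if e: "e \<in> E" for e
  proof -
    have "iso_proj A e e" 
      unfolding iso_proj_def using minprojD[OF min[OF e]] by (intro bexI[of _ e]) simp_all
    then have "\<exists>r. r \<in> E \<and> iso_proj A e r" using e by blast
    then have "rep e \<in> E \<and> iso_proj A e (rep e)" unfolding rep_def by (rule someI_ex)
    then show "rep e \<in> E" "iso_proj A e (rep e)" by auto
  qed
  have rep_eq: "rep e = rep f" if "e \<in> E" "f \<in> E" "iso_proj A e f" for e f
  proof -
    have "iso_proj A e r \<longleftrightarrow> iso_proj A f r" for r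
      using that iso_proj_sym[OF A(1)] iso_proj_trans[OF A(1)] minprojD(3)[OF min] by blast
    then show ?thesis by (simp add: rep_def)
  qed
  obtain v where v: "\<And>e. e \<in> E \<Longrightarrow> v e \<in> A" "\<And>e. e \<in> E \<Longrightarrow> adj (v e) ** v e = rep e"
    "\<And>e. e \<in> E \<Longrightarrow> v e ** adj (v e) = e"
    using rep(2) unfolding iso_proj_def by metis
  have vrep: "v e ** rep e = v e" if "e \<in> E" for e
    using partial_isometry_absorb[OF v(2)[OF that]] minprojD(3)[OF min[OF rep(1)[OF that]]] by blast
  have repv: "rep e ** adj (v e) = adj (v e)" if "e \<in> E" for e
    using vrep[OF that] minprojD(2)[OF min[OF rep(1)[OF that]]] by (metis adj_mult)
  have corner0: "e ** X ** f = 0" if "e \<in> E" "f \<in> E" "rep e \<noteq> rep f" "X \<in> A" for e f X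
  proof (rule ccontr)
    assume "e ** X ** f \<noteq> 0"
    then have "iso_proj A e f" by (rule minproj_partial_isometry[OF A(1) min[OF that(1)] min[OF that(2)] that(4)])
    then show False using rep_eq that by blast
  qed
  \<comment> \<open>Conjugating by the partial isometries moves the corner between \<open>e\<close>
    and \<open>f\<close> to the corner of their common representative, which is
    one-dimensional.\<close>
  have corner: "\<exists>c. e ** X ** f = cscale c (v e ** adj (v f))"
    if ef: "e \<in> E" "f \<in> E" "rep e = rep f" and X: "X \<in> A" for e f X
  proof -
    have "adj (v e) ** X ** v f \<in> A" using v(1) ef X by (intro sA(2,3)) auto
    then obtain c where c: "rep e ** (adj (v e) ** X ** v f) ** rep e = cscale c (rep e)"
      using minprojD(5)[OF min[OF rep(1)[OF ef(1)]]] by blast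
    have rf: "rep e ** adj (v f) = adj (v f)" using repv[OF ef(2)] ef(3) by simp
    have "e ** X ** f = (v e ** adj (v e)) ** X ** (v f ** adj (v f))" by (simp add: v ef)
    also have "\<dots> = v e ** (adj (v e) ** X ** v f) ** adj (v f)" by (simp only: matrix_mul_assoc)
    also have "\<dots> = (v e ** rep e) ** (adj (v e) ** X ** v f) ** (rep e ** adj (v f))"
      by (simp only: vrep[OF ef(1)] rf)
    also have "\<dots> = v e ** (rep e ** (adj (v e) ** X ** v f) ** rep e) ** adj (v f)"
      by (simp only: matrix_mul_assoc)
    also have "\<dots> = cscale c (v e ** adj (v f))"
      by (simp only: c cscale_mult_left cscale_mult_right vrep[OF ef(1)])
    finally show ?thesis by blast
  qed
  have "\<exists>F. orth_minprojs UNIV F \<and> \<Sum>F = r" if "r \<in> E" for r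
    using projection_decomposition[OF star_algebra_UNIV, of r] minprojD[OF min[OF that]]
    by (auto simp: projection_def)
  then obtain F where F: "\<And>r. r \<in> E \<Longrightarrow> orth_minprojs UNIV (F r)" "\<And>r. r \<in> E \<Longrightarrow> \<Sum>(F r) = r"
    by metis
  have finF: "finite (F r)" and minF: "\<And>p. p \<in> F r \<Longrightarrow> minproj UNIV p" if "r \<in> E" for r
    using F(1)[OF that] by (auto simp: orth_minprojs_def)
  define x where "x p = (SOME y. p = outer y y \<and> cip y y = 1)" for p :: "'n op"
  have x: "outer (x p) (x p) = p" "cip (x p) (x p) = 1" if "minproj UNIV p" for p
    using someI_ex[OF rank_one_minproj[OF that]] by (auto simp: x_def)
  define I where "I = Sigma E (\<lambda>e. F (rep e))"
  define u where "u = (\<lambda>(e, p). v e *v x p)"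
  have outer_u: "outer (u (e, p)) (u (f, p')) = v e ** outer (x p) (x p') ** adj (v f)" for e f p p'
    by (simp add: u_def mult_outer outer_mult)
  \<comment> \<open>The \<open>p\<close> split \<open>rep e\<close> into rank-one projections of the
    full operator algebra, generally outside \<open>A\<close>. Summing over them restores
    \<open>rep e\<close>, which is how the identity on the multiplicity space arises.\<close>
  have sum_outer: "(\<Sum>p\<in>F (rep e). outer (u (e, p)) (u (f, p))) = v e ** adj (v f)"
    if e: "e \<in> E" for e f
  proof -
    have "(\<Sum>p\<in>F (rep e). outer (u (e, p)) (u (f, p))) = (\<Sum>p\<in>F (rep e). v e ** p ** adj (v f))"
      by (rule sum.cong) (use x minF rep(1)[OF e] in \<open>auto simp: outer_u\<close>)
    also have "\<dots> = v e ** (\<Sum>p\<in>F (rep e). p) ** adj (v f)"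
      by (simp add: mult_sum_left mult_sum_right)
    finally show ?thesis using F(2)[OF rep(1)[OF e]] vrep[OF e] by simp
  qed
  have finI: "finite I" unfolding I_def using fin finF rep(1) by blast
  have sumI: "(\<Sum>a\<in>I. h a) = (\<Sum>e\<in>E. \<Sum>p\<in>F (rep e). h (e, p))" for h :: "_ \<Rightarrow> 'n op"
    unfolding I_def by (subst sum.Sigma) (use fin finF rep(1) in \<open>auto simp: case_prod_unfold\<close>)
  have sum_I: "(\<Sum>a\<in>I. outer (u a) (u a)) = mat 1"
  proof -
    have "(\<Sum>a\<in>I. outer (u a) (u a)) = (\<Sum>e\<in>E. \<Sum>p\<in>F (rep e). outer (u (e, p)) (u (e, p)))"
      by (rule sumI)
    also have "\<dots> = \<Sum>E" by (rule sum.cong) (auto simp: sum_outer v)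
    finally show ?thesis by (simp add: E)
  qed
  have norm_u: "cip (u a) (u a) = 1" if aI: "a \<in> I" for a
  proof -
    obtain e p where a: "a = (e, p)" "e \<in> E" "p \<in> F (rep e)" using aI by (auto simp: I_def)
    have mp: "minproj UNIV p" using a minF rep(1) by blast
    have "outer (x p) (x p) *v x p = x p"
      using x(2)[OF mp]
      by (simp add: vec_eq_iff outer_def matrix_vector_mult_def cip_def mult.assoc
          sum_distrib_left[symmetric])
    then have px: "p *v x p = x p" by (simp add: x(1)[OF mp])
    have "p ** rep e = p"
      using orthogonal_sum_absorb[of "F (rep e)" p] F[OF rep(1)[OF a(2)]] a(3) mp
      by (auto simp: orth_minprojs_def minproj_def)
    then have "rep e ** p = p"
      using projection_absorb_swap minprojD(2) mp min[OF rep(1)[OF a(2)]] by blast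
    then have "rep e *v x p = x p" using px by (metis matrix_vector_mul_assoc)
    then have "adj (v e) *v (v e *v x p) = x p"
      by (simp add: matrix_vector_mul_assoc v(2)[OF a(2)])
    then show ?thesis
      using cip_adj[of "u a" "v e" "x p"] x(2)[OF mp] by (simp add: a u_def)
  qed
  \<comment> \<open>Taking traces in the resolution of the identity counts the unit vectors. There
    are as many as the dimension, so they fill a square matrix and \<open>U ** adj U = mat 1\<close>
    alone gives unitarity.\<close>
  have "of_nat (card I) = (\<Sum>a\<in>I. cip (u a) (u a))" by (simp add: norm_u)
  also have "\<dots> = tr (\<Sum>a\<in>I. outer (u a) (u a))" by (simp add: tr_sum tr_outer)
  also have "\<dots> = of_nat CARD('n)" by (simp add: sum_I tr_one)
  finally have "card (UNIV::'n set) = card I" by (metis of_nat_eq_iff)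
  then obtain g where g: "bij_betw g (UNIV::'n set) I"
    using finite_same_card_bij[OF finite finI] by blast
  define U where "U = (\<chi> i j. u (g j) $ i)"
  have "U ** adj U = U ** mat 1 ** adj U" by simp
  also have "\<dots> = (\<Sum>i\<in>UNIV. \<Sum>j\<in>UNIV. cscale (mat 1 $ i $ j) (outer (u (g i)) (u (g j))))"
    unfolding U_def by (rule conj_by_columns)
  also have "\<dots> = (\<Sum>i\<in>UNIV. outer (u (g i)) (u (g i)))"
    by (rule sum.cong[OF refl], subst sum_single) (auto simp: mat_def)
  also have "\<dots> = mat 1"
    using sum.reindex_bij_betw[OF g, of "\<lambda>a. outer (u a) (u a)"] sum_I by simp
  finally have unit: "unitary U" by (simp add: unitary_def matrix_left_right_inverse)
  define R where "R = rep ` E"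
  have finR: "finite R" and RE: "R \<subseteq> E" using fin rep(1) by (auto simp: R_def)
  define cls where "cls r = {e \<in> E. rep e = r}" for r
  obtain iR where iR: "bij_betw iR R {0..<card R}" using ex_bij_betw_finite_nat[OF finR] by blast
  have "\<exists>i. bij_betw i (cls r) {0..<card (cls r)}" for r
    using ex_bij_betw_finite_nat[of "cls r"] fin by (simp add: cls_def)
  then obtain iS where iS: "\<And>r. bij_betw (iS r) (cls r) {0..<card (cls r)}" by metis
  have "\<exists>i. r \<in> E \<longrightarrow> bij_betw i (F r) {0..<card (F r)}" for r
    using ex_bij_betw_finite_nat finF by blast
  then obtain iF where iF: "\<And>r. r \<in> E \<Longrightarrow> bij_betw (iF r) (F r) {0..<card (F r)}" by metis
  define jR where "jR = inv_into R iR"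
  have jR: "jR (iR r) = r" if "r \<in> R" for r
    using that iR by (simp add: jR_def bij_betw_inv_into_left)
  have jR': "jR l \<in> R" "iR (jR l) = l" if "l < card R" for l
    using that iR by (auto simp: jR_def bij_betw_inv_into_right bij_betw_def inv_into_into f_inv_into_f)
  define dS where "dS l = card (cls (jR l))" for l
  define dF where "dF l = card (F (jR l))" for l
  define lb where "lb = (\<lambda>(e, p). (iR (rep e), iS (rep e) e, iF (rep e) p))"
  define lab where "lab = lb \<circ> g"
  have repR: "rep e \<in> R" if "e \<in> E" for e using that by (simp add: R_def)
  have "bij_betw lb I {(l, s, f). l < card R \<and> s < dS l \<and> f < dF l}"
    unfolding bij_betw_def
  proof
    show "inj_on lb I"
    proof (rule inj_onI, clarsimp simp: I_def lb_def)
      fix e p e' p'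
      assume e: "e \<in> E" "p \<in> F (rep e)" "e' \<in> E" "p' \<in> F (rep e')"
        and eq: "iR (rep e) = iR (rep e')" "iS (rep e) e = iS (rep e') e'" "iF (rep e) p = iF (rep e') p'"
      have r: "rep e = rep e'" using eq(1) repR jR e by metis
      then have "e = e'"
        using iS[of "rep e"] eq(2) e by (auto simp: bij_betw_def inj_on_def cls_def)
      moreover have "p = p'"
        using iF[OF rep(1)[OF e(1)]] eq(3) e r by (auto simp: bij_betw_def inj_on_def)
      ultimately show "e = e' \<and> p = p'" by simp
    qed
    show "lb ` I = {(l, s, f). l < card R \<and> s < dS l \<and> f < dF l}"
    proof (intro equalityI subsetI)
      fix t assume "t \<in> lb ` I"
      then obtain e p where t: "t = lb (e, p)" "e \<in> E" "p \<in> F (rep e)" by (auto simp: I_def)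
      have "iR (rep e) < card R" using bij_betwE[OF iR] repR t by fastforce
      moreover have "iS (rep e) e < card (cls (rep e))"
        using bij_betwE[OF iS[of "rep e"]] t by (fastforce simp: cls_def)
      moreover have "iF (rep e) p < card (F (rep e))"
        using bij_betwE[OF iF[OF rep(1)]] t by fastforce
      ultimately show "t \<in> {(l, s, f). l < card R \<and> s < dS l \<and> f < dF l}"
        using jR[OF repR[OF t(2)]] by (simp add: t lb_def dS_def dF_def)
    next
      fix t assume "t \<in> {(l, s, f). l < card R \<and> s < dS l \<and> f < dF l}"
      then obtain l s f where t: "t = (l, s, f)" "l < card R" "s < dS l" "f < dF l" by auto
      have "s \<in> iS (jR l) ` cls (jR l)"
        using iS[of "jR l"] t(3) by (auto simp: bij_betw_def dS_def)
      then obtain e where e: "e \<in> E" "rep e = jR l" "iS (jR l) e = s" by (auto simp: cls_def)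
      have "f \<in> iF (jR l) ` F (jR l)"
        using iF[of "jR l"] jR'(1)[OF t(2)] RE t(4) by (auto simp: bij_betw_def dF_def)
      then obtain p where p: "p \<in> F (jR l)" "iF (jR l) p = f" by auto
      have "lb (e, p) = t" using e p jR'[OF t(2)] by (simp add: lb_def t)
      moreover have "(e, p) \<in> I" using e p by (simp add: I_def)
      ultimately show "t \<in> lb ` I" by blast
    qed
  qed
  then have bs: "block_struct (card R) dS dF lab"
    unfolding block_struct_def lab_def by (rule bij_betw_trans[OF g])
  define one where "one = (\<lambda>(l::nat) (f::nat) (f'::nat). if f = f' then 1 else (0::complex))"
  define K where "K B = U ** block_tensor lab B one ** adj U" for B
  define b where "b B e f = B (iR (rep e)) (iS (rep e) e) (iS (rep e) f)"
    for B :: "nat \<Rightarrow> nat \<Rightarrow> nat \<Rightarrow> complex" and e f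
  \<comment> \<open>Block operators expand in the matrix units \<open>v e ** adj (v f)\<close> of
    equivalent projections, the same operators that span the corners of \<open>A\<close>.\<close>
  have K: "K B = (\<Sum>e\<in>E. \<Sum>f\<in>E. if rep e = rep f then cscale (b B e f) (v e ** adj (v f)) else 0)" for B
  proof -
    define \<beta> where "\<beta> a c = (case lb a of (l, s, f) \<Rightarrow> case lb c of (l', s', f') \<Rightarrow>
        if l = l' then B l s s' * one l f f' else 0)" for a c
    have "K B = (\<Sum>i\<in>UNIV. \<Sum>j\<in>UNIV. cscale (\<beta> (g i) (g j)) (outer (u (g i)) (u (g j))))"
      unfolding K_def U_def conj_by_columns by (simp add: block_tensor_def lab_def \<beta>_def)
    also have "\<dots> = (\<Sum>a\<in>I. \<Sum>c\<in>I. cscale (\<beta> a c) (outer (u a) (u c)))"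
      by (simp add: sum.reindex_bij_betw[OF g, of "\<lambda>c. cscale (\<beta> (g _) c) (outer (u (g _)) (u c))"]
          sum.reindex_bij_betw[OF g, of "\<lambda>a. \<Sum>c\<in>I. cscale (\<beta> a c) (outer (u a) (u c))"])
    also have "\<dots> = (\<Sum>e\<in>E. \<Sum>p\<in>F (rep e). \<Sum>f\<in>E. \<Sum>p'\<in>F (rep f).
        cscale (\<beta> (e, p) (f, p')) (outer (u (e, p)) (u (f, p'))))"
      by (simp only: sumI)
    also have "\<dots> = (\<Sum>e\<in>E. \<Sum>f\<in>E. \<Sum>p\<in>F (rep e). \<Sum>p'\<in>F (rep f).
        cscale (\<beta> (e, p) (f, p')) (outer (u (e, p)) (u (f, p'))))"
      by (rule sum.cong[OF refl]) (rule sum.swap)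
    also have "\<dots> = (\<Sum>e\<in>E. \<Sum>f\<in>E. if rep e = rep f then cscale (b B e f) (v e ** adj (v f)) else 0)"
    proof (intro sum.cong refl)
      fix e f assume ef: "e \<in> E" "f \<in> E"
      show "(\<Sum>p\<in>F (rep e). \<Sum>p'\<in>F (rep f). cscale (\<beta> (e, p) (f, p')) (outer (u (e, p)) (u (f, p'))))
        = (if rep e = rep f then cscale (b B e f) (v e ** adj (v f)) else 0)"
      proof (cases "rep e = rep f")
        case False
        then have "iR (rep e) \<noteq> iR (rep f)" using jR repR ef by metis
        then show ?thesis using False by (simp add: \<beta>_def lb_def)
      next
        case True
        have "(\<Sum>p'\<in>F (rep f). cscale (\<beta> (e, p) (f, p')) (outer (u (e, p)) (u (f, p'))))
            = cscale (b B e f) (outer (u (e, p)) (u (f, p)))" if p: "p \<in> F (rep e)" for p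
        proof (subst sum_single[of _ p])
          show "finite (F (rep f))" "p \<in> F (rep f)" using finF rep(1) ef p True by auto
          show "cscale (\<beta> (e, p) (f, q)) (outer (u (e, p)) (u (f, q))) = 0"
            if q: "q \<in> F (rep f)" "q \<noteq> p" for q
          proof -
            have "iF (rep f) p \<noteq> iF (rep f) q"
              using iF[OF rep(1)[OF ef(2)]] p q True by (auto simp: bij_betw_def inj_on_def)
            then show ?thesis using True by (simp add: \<beta>_def lb_def one_def)
          qed
          show "cscale (\<beta> (e, p) (f, p)) (outer (u (e, p)) (u (f, p)))
              = cscale (b B e f) (outer (u (e, p)) (u (f, p)))"
            using True by (simp add: \<beta>_def lb_def one_def b_def)
        qed
        then have "(\<Sum>p\<in>F (rep e). \<Sum>p'\<in>F (rep f). cscale (\<beta> (e, p) (f, p')) (outer (u (e, p)) (u (f, p'))))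
            = (\<Sum>p\<in>F (rep e). cscale (b B e f) (outer (u (e, p)) (u (f, p))))"
          by (intro sum.cong) auto
        also have "\<dots> = cscale (b B e f) (\<Sum>p\<in>F (rep e). outer (u (e, p)) (u (f, p)))"
          by (simp add: vec_eq_iff sum_distrib_left)
        finally show ?thesis using True sum_outer[OF ef(1)] by simp
      qed
    qed
    finally show ?thesis .
  qed
  have "A = {K B | B. True}"
  proof (intro equalityI subsetI)
    fix X assume X: "X \<in> A"
    have "\<exists>c. e \<in> E \<longrightarrow> f \<in> E \<longrightarrow> rep e = rep f \<longrightarrow> e ** X ** f = cscale c (v e ** adj (v f))" for e f
      using corner[OF _ _ _ X] by blast
    then obtain c where c: "\<And>e f. e \<in> E \<Longrightarrow> f \<in> E \<Longrightarrow> rep e = rep f \<Longrightarrow>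
        e ** X ** f = cscale (c e f) (v e ** adj (v f))" by metis
    \<comment> \<open>Recovers a projection from its block and its number within the class. For
      labels out of range \<open>B\<close> is unspecified, but no entry of
      \<open>block_tensor\<close> reads it there.\<close>
    define jS where "jS l = inv_into (cls (jR l)) (iS (jR l))" for l
    define B where "B l s s' = c (jS l s) (jS l s')" for l s s'
    have jS: "jS (iR (rep e)) (iS (rep e) f) = f" if "e \<in> E" "f \<in> E" "rep f = rep e" for e f
      using bij_betw_inv_into_left[OF iS[of "rep e"], of f] that jR repR by (simp add: jS_def cls_def)
    have "X = \<Sum>E ** X ** \<Sum>E" by (simp add: E)
    also have "\<dots> = (\<Sum>e\<in>E. \<Sum>f\<in>E. e ** X ** f)"
      using mult_sum_left[of "\<lambda>e. e" E X] mult_sum_right[of "\<Sum>E ** X" "\<lambda>e. e" E]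
      by (simp add: mult_sum_left mult_sum_right) (rule sum.swap)
    also have "\<dots> = K B"
      unfolding K
    proof (intro sum.cong refl)
      fix e f assume "e \<in> E" "f \<in> E"
      moreover have "b B e f = c e f" if "rep e = rep f"
        using jS[of e e] jS[of e f] that calculation by (simp only: b_def B_def)
      ultimately show "e ** X ** f = (if rep e = rep f then cscale (b B e f) (v e ** adj (v f)) else 0)"
        using c[of e f] corner0[of e f X] X by simp
    qed
    finally show "X \<in> {K B | B. True}" by blast
  next
    fix X assume "X \<in> {K B | B. True}"
    then obtain B where "X = K B" by blast
    moreover have "v e ** adj (v f) \<in> A" if "e \<in> E" "f \<in> E" for e f
      using that v(1) by (intro sA(2,3)) auto
    ultimately show "X \<in> A"
      unfolding K by (auto intro!: csubspace_sum[OF sA(1)] csubspace_cscale[OF sA(1)] csubspace_zero[OF sA(1)])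
  qed
  then have "wedderburn A U (card R) dS dF lab"
    using unit bs unfolding wedderburn_def K_def one_def by blast
  then show ?thesis by blast
qed

subsection \<open>Compatible operators\<close>

text \<open>The factors act on different tensor legs, so the sum over the intermediate index has at
  most one nonzero term, at label \<open>(l, s', f)\<close> or \<open>(l, s, f')\<close>. This label
  occurs because a block structure realizes all triples within the bounds.\<close>

lemma block_tensor_mult:
  fixes lab :: "'n::finite \<Rightarrow> nat \<times> nat \<times> nat"
  assumes bs: "block_struct L dS dF lab"
  shows "block_tensor lab B (\<lambda>l f f'. if f = f' then 1 else 0)
      ** block_tensor lab (\<lambda>l s s'. if s = s' then 1 else 0) C = block_tensor lab B C" (is "?P ** ?Q = _")
    and "block_tensor lab (\<lambda>l s s'. if s = s' then 1 else 0) C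
      ** block_tensor lab B (\<lambda>l f f'. if f = f' then 1 else 0) = block_tensor lab B C"
proof -
  have bij: "bij_betw lab UNIV {(l, s, f). l < L \<and> s < dS l \<and> f < dF l}"
    using bs by (simp add: block_struct_def)
  have ex: "\<exists>k. lab k = (l, s, f)" if "l < L" "s < dS l" "f < dF l" for l s f
  proof -
    have "(l, s, f) \<in> lab ` UNIV" using that bij by (simp add: bij_betw_def)
    then show ?thesis by force
  qed
  have inj: "lab k = lab k' \<Longrightarrow> k = k'" for k k' using bij by (auto simp: bij_betw_def inj_on_def)
  have bound: "l < L \<and> s < dS l \<and> f < dF l" if "lab i = (l, s, f)" for i l s f
    using bij_betwE[OF bij, rule_format, of i] that by simp
  have "(?P ** ?Q) $ i $ j = block_tensor lab B C $ i $ j" for i j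
  proof -
    obtain l s f where i: "lab i = (l, s, f)" by (metis prod_cases3)
    obtain l' s' f' where j: "lab j = (l', s', f')" by (metis prod_cases3)
    have entry: "(?P ** ?Q) $ i $ j = (\<Sum>k\<in>UNIV. ?P $ i $ k * ?Q $ k $ j)"
      by (simp add: matrix_matrix_mult_def)
    show ?thesis
    proof (cases "l = l'")
      case False
      then have zero: "?P $ i $ k * ?Q $ k $ j = 0" for k
        by (auto simp: block_tensor_def i j split: prod.splits)
      show ?thesis
        unfolding entry zero using False by (simp add: block_tensor_def i j)
    next
      case True
      then obtain k where k: "lab k = (l, s', f)" using ex bound[OF i] bound[OF j] by blast
      have z: "?P $ i $ k' * ?Q $ k' $ j = 0" if "k' \<noteq> k" for k'
        using that inj[of k' k] True by (auto simp: block_tensor_def i j k split: prod.splits)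
      have "(?P ** ?Q) $ i $ j = ?P $ i $ k * ?Q $ k $ j"
        unfolding entry by (rule sum_single) (use z in auto)
      then show ?thesis using True by (simp add: block_tensor_def i j k)
    qed
  qed
  then show "?P ** ?Q = block_tensor lab B C" by (simp add: vec_eq_iff)
  have "(?Q ** ?P) $ i $ j = block_tensor lab B C $ i $ j" for i j
  proof -
    obtain l s f where i: "lab i = (l, s, f)" by (metis prod_cases3)
    obtain l' s' f' where j: "lab j = (l', s', f')" by (metis prod_cases3)
    have entry: "(?Q ** ?P) $ i $ j = (\<Sum>k\<in>UNIV. ?Q $ i $ k * ?P $ k $ j)"
      by (simp add: matrix_matrix_mult_def)
    show ?thesis
    proof (cases "l = l'")
      case False
      then have zero: "?Q $ i $ k * ?P $ k $ j = 0" for k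
        by (auto simp: block_tensor_def i j split: prod.splits)
      show ?thesis
        unfolding entry zero using False by (simp add: block_tensor_def i j)
    next
      case True
      then obtain k where k: "lab k = (l, s, f')" using ex bound[OF i] bound[OF j] by blast
      have z: "?Q $ i $ k' * ?P $ k' $ j = 0" if "k' \<noteq> k" for k'
        using that inj[of k' k] True by (auto simp: block_tensor_def i j k split: prod.splits)
      have "(?Q ** ?P) $ i $ j = ?Q $ i $ k * ?P $ k $ j"
        unfolding entry by (rule sum_single) (use z in auto)
      then show ?thesis using True by (simp add: block_tensor_def i j k)
    qed
  qed
  then show "?Q ** ?P = block_tensor lab B C" by (simp add: vec_eq_iff)
qed

lemma unitary_conj_mult:
  assumes "unitary U"
  shows "(U ** X ** adj U) ** (U ** Y ** adj U) = U ** (X ** Y) ** adj U"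
proof -
  have "(U ** X ** adj U) ** (U ** Y ** adj U) = U ** X ** (adj U ** U) ** Y ** adj U"
    by (simp only: matrix_mul_assoc)
  moreover have "adj U ** U = mat 1" using assms by (simp add: unitary_def)
  ultimately show ?thesis by (simp only: matrix_mul_rid matrix_mul_assoc)
qed

text \<open>Blockwise \<open>\<rho>S \<otimes> \<tau>F\<close> is the product of
  \<open>\<rho>S \<otimes> 1\<close> in the algebra and \<open>1 \<otimes> \<tau>F\<close> in its
  commutant; from here on no coordinates are needed for \<rho>.\<close>

lemma compatible_factors:
  assumes "compatible \<rho> A"
  obtains r t where "r \<in> A" "t \<in> commutant A" "\<rho> = r ** t"
proof -
  obtain U L dS dF lab \<rho>S \<tau>F where w: "wedderburn A U L dS dF lab"
    and \<rho>: "\<rho> = U ** block_tensor lab \<rho>S \<tau>F ** adj U"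
    using assms by (auto simp: compatible_def)
  let ?P = "\<lambda>B. block_tensor lab B (\<lambda>l f f'. if f = f' then 1 else 0)"
  let ?Q = "block_tensor lab (\<lambda>l s s'. if s = s' then 1 else 0) \<tau>F"
  have U: "unitary U" and bs: "block_struct L dS dF lab"
    and A: "A = {U ** ?P B ** adj U | B. True}"
    using w by (auto simp: wedderburn_def)
  show ?thesis
  proof (rule that[of "U ** ?P \<rho>S ** adj U" "U ** ?Q ** adj U"])
    show "U ** ?P \<rho>S ** adj U \<in> A" by (subst A) blast
    show "U ** ?Q ** adj U \<in> commutant A"
      by (subst A) (auto simp: commutant_def unitary_conj_mult[OF U] block_tensor_mult[OF bs])
    show "\<rho> = (U ** ?P \<rho>S ** adj U) ** (U ** ?Q ** adj U)"
      by (simp add: \<rho> unitary_conj_mult[OF U] block_tensor_mult[OF bs])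
  qed
qed

text \<open>Commuting with all blocks \<open>B \<otimes> 1\<close> leaves only operators of the form
  \<open>1 \<otimes> C\<close>, which are compatible with the identity as first factor.\<close>

lemma commutant_compatible:
  fixes A :: "'n::finite op set"
  assumes A: "star_algebra A" "mat 1 \<in> A" and X: "X \<in> commutant A"
  shows "compatible X A"
proof -
  obtain U L dS dF and lab :: "'n \<Rightarrow> nat \<times> nat \<times> nat" where w: "wedderburn A U L dS dF lab"
    using wedderburn_exists[OF A] by blast
  let ?P = "\<lambda>B. block_tensor lab B (\<lambda>l f f'. if f = f' then 1 else 0)"
  have U: "unitary U" and bs: "block_struct L dS dF lab"
    and A: "A = {U ** ?P B ** adj U | B. True}"
    using w by (auto simp: wedderburn_def)
  define T where "T = adj U ** X ** U"
  have XT: "X = U ** T ** adj U"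
  proof -
    have "U ** T ** adj U = (U ** adj U) ** X ** (U ** adj U)"
      by (simp only: T_def matrix_mul_assoc)
    then show ?thesis using U by (simp add: unitary_def)
  qed
  have comm: "?P B ** T = T ** ?P B" for B
  proof -
    have "U ** ?P B ** adj U \<in> A" by (subst A) blast
    then have "X ** (U ** ?P B ** adj U) = (U ** ?P B ** adj U) ** X" by (rule commutantD[OF X])
    then have "U ** (T ** ?P B) ** adj U = U ** (?P B ** T) ** adj U"
      by (simp only: XT unitary_conj_mult[OF U])
    moreover have "adj U ** (U ** Z ** adj U) ** U = Z" for Z
    proof -
      have "adj U ** (U ** Z ** adj U) ** U = (adj U ** U) ** Z ** (adj U ** U)"
        by (simp only: matrix_mul_assoc)
      then show ?thesis using U by (simp add: unitary_def)
    qed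
    ultimately show ?thesis by metis
  qed
  have bij: "bij_betw lab UNIV {(l, s, f). l < L \<and> s < dS l \<and> f < dF l}"
    using bs by (simp add: block_struct_def)
  have inj: "lab k = lab k' \<Longrightarrow> k = k'" for k k' using bij by (auto simp: bij_betw_def inj_on_def)
  have bound: "l < L \<and> s < dS l \<and> f < dF l" if "lab i = (l, s, f)" for i l s f
    using bij_betwE[OF bij, rule_format, of i] that by simp
  define idx where "idx = inv lab"
  have idx: "lab (idx (l, s, f)) = (l, s, f)" if "l < L" "s < dS l" "f < dF l" for l s f
  proof -
    have "(l, s, f) \<in> lab ` UNIV" using that bij by (simp add: bij_betw_def)
    then show ?thesis by (simp add: idx_def f_inv_into_f)
  qed
  \<comment> \<open>The slot \<open>s = 0\<close> occurs in every block that carries a basis vector,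
    since \<open>s < dS l\<close> forces \<open>0 < dS l\<close>.\<close>
  define \<tau> where "\<tau> l f f' = T $ idx (l, 0, f) $ idx (l, 0, f')" for l f f'
  have "T $ i $ j = block_tensor lab (\<lambda>l s s'. if s = s' then 1 else 0) \<tau> $ i $ j" for i j
  proof -
    obtain l s f where i: "lab i = (l, s, f)" by (metis prod_cases3)
    obtain l' s' f' where j: "lab j = (l', s', f')" by (metis prod_cases3)
    \<comment> \<open>Compare entries in the commutation relation of \<open>T\<close> with the matrix unit \<open>0s\<close> of block \<open>l\<close>.\<close>
    define B :: "nat \<Rightarrow> nat \<Rightarrow> nat \<Rightarrow> complex"
      where "B m a b = (if m = l \<and> a = 0 \<and> b = s then 1 else 0)" for m a b
    define i0 where "i0 = idx (l, 0, f)"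
    have i0: "lab i0 = (l, 0, f)" unfolding i0_def using bound[OF i] by (intro idx) auto
    have "(?P B ** T) $ i0 $ j = (\<Sum>k\<in>UNIV. ?P B $ i0 $ k * T $ k $ j)"
      by (simp add: matrix_matrix_mult_def)
    also have "\<dots> = ?P B $ i0 $ i * T $ i $ j"
    proof (rule sum_single)
      fix k assume "k \<noteq> i"
      then have "lab k \<noteq> (l, s, f)" using inj i by metis
      then show "?P B $ i0 $ k * T $ k $ j = 0"
        by (auto simp: block_tensor_def B_def i0 split: prod.splits)
    qed auto
    also have "\<dots> = T $ i $ j" by (simp add: block_tensor_def B_def i0 i)
    finally have 1: "T $ i $ j = (T ** ?P B) $ i0 $ j" by (simp add: comm)
    have 2: "(T ** ?P B) $ i0 $ j = (\<Sum>k\<in>UNIV. T $ i0 $ k * ?P B $ k $ j)"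
      by (simp add: matrix_matrix_mult_def)
    show ?thesis
    proof (cases "l = l' \<and> s = s'")
      case False
      then have zero: "T $ i0 $ k * ?P B $ k $ j = 0" for k
        by (auto simp: block_tensor_def B_def j split: prod.splits)
      have "T $ i $ j = 0" unfolding 1 2 zero by simp
      then show ?thesis using False by (auto simp: block_tensor_def i j)
    next
      case True
      define j0 where "j0 = idx (l, 0, f')"
      have j0: "lab j0 = (l, 0, f')" unfolding j0_def using bound[OF j] True by (intro idx) auto
      have "(\<Sum>k\<in>UNIV. T $ i0 $ k * ?P B $ k $ j) = T $ i0 $ j0 * ?P B $ j0 $ j"
      proof (rule sum_single)
        fix k assume "k \<noteq> j0"
        then have "lab k \<noteq> (l, 0, f')" using inj j0 by metis
        then show "T $ i0 $ k * ?P B $ k $ j = 0"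
          using True by (auto simp: block_tensor_def B_def j split: prod.splits)
      qed auto
      also have "\<dots> = T $ i0 $ j0" using True by (simp add: block_tensor_def B_def j0 j)
      finally have "T $ i $ j = \<tau> l f f'" using 1 2 by (simp add: \<tau>_def i0_def j0_def)
      then show ?thesis using True by (simp add: block_tensor_def i j)
    qed
  qed
  then have "T = block_tensor lab (\<lambda>l s s'. if s = s' then 1 else 0) \<tau>" by (simp add: vec_eq_iff)
  then show ?thesis unfolding compatible_def using w XT by blast
qed

section \<open>Distorted algebras and the main theorem\<close>

lemma commuting_square:
  assumes "a ** b = b ** (a::'n::finite op)"
  shows "(a ** b) ** (a ** b) = (a ** a) ** (b ** b)"
proof -
  have "(a ** b) ** (a ** b) = a ** (b ** a) ** b" by (simp only: matrix_mul_assoc)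
  then show ?thesis by (simp only: assms[symmetric] matrix_mul_assoc)
qed

lemma alg_rho_superset: "S \<subseteq> alg_rho \<rho> S"
  unfolding alg_rho_def by blast

lemma star_algebra_commutant_of_star_algebra: "star_algebra A \<Longrightarrow> star_algebra (commutant A)"
  by (rule star_algebra_commutant) (rule star_algebraD(3))

text \<open>The factors of a compatible \<open>\<rho>\<close> need not be positive, but those of \<open>\<rho>\<^sup>2 = \<rho>\<^sup>\<dagger>\<rho>\<close> are.\<close>

lemma compatible_psqrt:
  assumes A: "star_algebra A" "mat 1 \<in> A" and \<rho>: "posdef \<rho>" "compatible \<rho> A"
  obtains a b where "a \<in> A" "b \<in> commutant A" "posdef a" "posdef b" "psqrt \<rho> = a ** b"
proof -
  have A': "star_algebra (commutant A)" "mat 1 \<in> commutant A"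
    using star_algebra_commutant_of_star_algebra[OF A(1)] one_in_commutant by auto
  obtain r t where rt: "r \<in> A" "t \<in> commutant A" "\<rho> = r ** t"
    using compatible_factors[OF \<rho>(2)] .
  have inv: "\<rho> ** matrix_inv \<rho> = mat 1" by (rule invertible_inv(1)[OF posdef_invertible[OF \<rho>(1)]])
  have "r ** (t ** matrix_inv \<rho>) = mat 1" using inv by (simp add: rt(3) matrix_mul_assoc)
  then have ir: "invertible r" by (auto simp: invertible_right_inverse)
  have tr: "t ** r = \<rho>" using commutantD[OF rt(2,1)] rt(3) by simp
  have "t ** (r ** matrix_inv \<rho>) = mat 1"
    unfolding matrix_mul_assoc tr by (rule inv)
  then have it: "invertible t" by (auto simp: invertible_right_inverse)
  define R where "R = adj r ** r"
  define T where "T = adj t ** t"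
  have RA: "R \<in> A" unfolding R_def using rt(1) by (intro star_algebraD(2,3)[OF A(1)])
  have TA: "T \<in> commutant A" unfolding T_def using rt(2) by (intro star_algebraD(2,3)[OF A'(1)])
  have pR: "posdef R" using posdef_conj[OF posdef_one ir] by (simp add: R_def)
  have pT: "posdef T" using posdef_conj[OF posdef_one it] by (simp add: T_def)
  have "\<rho> ** \<rho> = adj \<rho> ** \<rho>" by (simp add: posdef_hermitian[OF \<rho>(1)])
  also have "\<dots> = adj t ** R ** t" by (simp only: rt(3) R_def adj_mult matrix_mul_assoc)
  also have "\<dots> = R ** adj t ** t"
    by (simp only: commutantD[OF star_algebraD(3)[OF A'(1) rt(2)] RA])
  finally have sq: "\<rho> ** \<rho> = R ** T" by (simp only: T_def matrix_mul_assoc)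
  define r1 where "r1 = psqrt R"
  define t1 where "t1 = psqrt T"
  have r1: "posdef r1" "r1 ** r1 = R" "r1 \<in> A"
    using psqrt[OF pR] A RA by (simp_all add: r1_def)
  have t1: "posdef t1" "t1 ** t1 = T" "t1 \<in> commutant A"
    using psqrt[OF pT] A' TA by (simp_all add: t1_def)
  have c1: "r1 ** t1 = t1 ** r1" using commutantD[OF t1(3) r1(3)] by simp
  have \<rho>1: "\<rho> = r1 ** t1"
  proof (rule posdef_sqrt_unique[OF \<rho>(1) posdef_mult_commuting[OF r1(1) t1(1) c1]])
    show "\<rho> ** \<rho> = (r1 ** t1) ** (r1 ** t1)"
      by (simp only: sq commuting_square[OF c1] r1(2) t1(2))
  qed
  \<comment> \<open>With \<rho> itself a product of commuting positive factors, extracting roots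
    once more splits \<open>psqrt \<rho>\<close>.\<close>
  define a where "a = psqrt r1"
  define b where "b = psqrt t1"
  have a: "posdef a" "a ** a = r1" "a \<in> A"
    using psqrt[OF r1(1)] A r1(3) by (simp_all add: a_def)
  have b: "posdef b" "b ** b = t1" "b \<in> commutant A"
    using psqrt[OF t1(1)] A' t1(3) by (simp_all add: b_def)
  have c: "a ** b = b ** a" using commutantD[OF b(3) a(3)] by simp
  have "psqrt \<rho> = a ** b"
    by (rule psqrt_eqI[OF posdef_mult_commuting[OF a(1) b(1) c]])
      (simp only: \<rho>1 commuting_square[OF c] a(2) b(2))
  then show ?thesis using that a b by blast
qed

section \<open>Passing between distorted and ordinary algebras\<close>

lemma Dinv_psqrt:
  assumes "posdef \<rho>"
  shows "psqrt \<rho> ** Dinv \<rho> X ** psqrt \<rho> = X"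
    and "Dinv \<rho> (psqrt \<rho> ** X ** psqrt \<rho>) = X"
proof -
  note i = invertible_inv[OF posdef_invertible[OF psqrt(1)[OF assms]]]
  have "psqrt \<rho> ** Dinv \<rho> X ** psqrt \<rho>
      = (psqrt \<rho> ** matrix_inv (psqrt \<rho>)) ** X ** (matrix_inv (psqrt \<rho>) ** psqrt \<rho>)"
    by (simp only: Dinv_def matrix_mul_assoc)
  then show "psqrt \<rho> ** Dinv \<rho> X ** psqrt \<rho> = X" by (simp add: i)
  have "Dinv \<rho> (psqrt \<rho> ** X ** psqrt \<rho>)
      = (matrix_inv (psqrt \<rho>) ** psqrt \<rho>) ** X ** (psqrt \<rho> ** matrix_inv (psqrt \<rho>))"
    by (simp only: Dinv_def matrix_mul_assoc)
  then show "Dinv \<rho> (psqrt \<rho> ** X ** psqrt \<rho>) = X" by (simp add: i)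
qed

lemma adj_Dinv: "posdef \<rho> \<Longrightarrow> adj (Dinv \<rho> X) = Dinv \<rho> (adj X)"
  by (simp add: Dinv_def adj_mult adj_matrix_inv posdef_invertible psqrt(1) posdef_hermitian
      matrix_mul_assoc)

text \<open>Congruence by the inverse root keeps \<open>V\<close> positive definite, so the
  generated algebra contains an invertible element and with it the identity.\<close>

lemma one_in_alg_Dinv:
  assumes "posdef \<rho>" "V \<in> S" "posdef V"
  shows "mat 1 \<in> alg (Dinv \<rho> ` S)"
proof (rule star_algebra_inverse(1)[OF star_algebra_alg])
  show "Dinv \<rho> V \<in> alg (Dinv \<rho> ` S)" using alg_superset assms(2) by blast
  note q = psqrt(1)[OF assms(1)]
  have "posdef (Dinv \<rho> V)"
    unfolding Dinv_def
    by (rule posdef_conj_hermitian[OF assms(3) invertible_matrix_inv[OF posdef_invertible[OF q]]])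
      (simp add: adj_matrix_inv posdef_invertible posdef_hermitian q)
  then show "invertible (Dinv \<rho> V)" by (rule posdef_invertible)
qed

lemma matrix_inv_psqrt_square:
  assumes "posdef \<rho>"
  shows "matrix_inv (psqrt \<rho>) ** matrix_inv (psqrt \<rho>) = matrix_inv \<rho>"
proof -
  define q where "q = psqrt \<rho>"
  have q: "q ** matrix_inv q = mat 1" "q ** q = \<rho>"
    using invertible_inv(1)[OF posdef_invertible[OF psqrt(1)[OF assms]]] psqrt(2)[OF assms]
    by (simp_all add: q_def)
  have "\<rho> ** (matrix_inv q ** matrix_inv q) = q ** (q ** matrix_inv q) ** matrix_inv q"
    by (simp only: q(2)[symmetric] matrix_mul_assoc)
  then have "\<rho> ** (matrix_inv (psqrt \<rho>) ** matrix_inv (psqrt \<rho>)) = mat 1"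
    by (simp add: q(1)) (simp add: q_def)
  then show ?thesis by (rule matrix_inv_unique[symmetric])
qed

text \<open>\<open>Dinv \<rho>\<close> turns the distorted product into the ordinary one, so it maps
  each \<rho>-distorted algebra containing \<open>S\<close> to a star-algebra containing the
  generators.\<close>

lemma Dinv_alg_rho:
  assumes "posdef \<rho>" "Z \<in> alg (Dinv \<rho> ` S)"
  shows "psqrt \<rho> ** Z ** psqrt \<rho> \<in> alg_rho \<rho> S"
  unfolding alg_rho_def
proof (rule InterI, clarify)
  fix D assume D: "distorted_algebra \<rho> D" "S \<subseteq> D"
  have sD: "csubspace D" using D(1) by (simp add: distorted_algebra_def)
  have "star_algebra (Dinv \<rho> ` D)"
    unfolding star_algebra_def
  proof (intro conjI ballI)
    show "csubspace (Dinv \<rho> ` D)" unfolding Dinv_def by (rule csubspace_image_mult[OF sD])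
    fix X assume "X \<in> Dinv \<rho> ` D"
    then obtain X' where X: "X' \<in> D" "X = Dinv \<rho> X'" by blast
    then show "adj X \<in> Dinv \<rho> ` D"
      using D(1) adj_Dinv[OF assms(1)] by (auto simp: distorted_algebra_def)
    fix Y assume "Y \<in> Dinv \<rho> ` D"
    then obtain Y' where Y: "Y' \<in> D" "Y = Dinv \<rho> Y'" by blast
    have "X ** Y = Dinv \<rho> (X' ** matrix_inv \<rho> ** Y')"
      by (simp only: X Y Dinv_def matrix_inv_psqrt_square[OF assms(1), symmetric] matrix_mul_assoc)
    then show "X ** Y \<in> Dinv \<rho> ` D" using D(1) X Y by (auto simp: distorted_algebra_def)
  qed
  moreover have "Dinv \<rho> ` S \<subseteq> Dinv \<rho> ` D" using D(2) by blast
  ultimately have "Z \<in> Dinv \<rho> ` D" using alg_minimal assms(2) by blast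
  then obtain X where "X \<in> D" "Z = Dinv \<rho> X" by blast
  then show "psqrt \<rho> ** Z ** psqrt \<rho> \<in> D" by (simp add: Dinv_psqrt(1)[OF assms(1)])
qed

text \<open>Writing \<open>\<sigma> = S ** \<tau>\<close> identifies
  \<open>\<tau> ** matrix_inv \<sigma>\<close> with the inverse of \<open>S\<close>, an element of
  \<open>N\<close>. Hence the middle factor of a \<sigma>-distorted product is absorbed by
  \<open>N\<close>.\<close>

lemma alg_rho_subset_of_factorization:
  fixes VV :: "'n::finite op set"
  assumes N: "star_algebra N" "mat 1 \<in> N" and t: "\<tau> \<in> commutant N" "adj \<tau> = \<tau>"
    and VV: "VV \<subseteq> (\<lambda>Z. Z ** \<tau>) ` N" and \<sigma>: "invertible \<sigma>" "\<sigma> \<in> (\<lambda>Z. Z ** \<tau>) ` N"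
  shows "alg_rho \<sigma> VV \<subseteq> (\<lambda>Z. Z ** \<tau>) ` N"
proof -
  note sN = star_algebraD[OF N(1)]
  obtain S where S: "S \<in> N" "\<sigma> = S ** \<tau>" using \<sigma>(2) by blast
  have "S ** (\<tau> ** matrix_inv \<sigma>) = mat 1"
    using invertible_inv(1)[OF \<sigma>(1)] by (simp add: S(2) matrix_mul_assoc)
  then have "matrix_inv S = \<tau> ** matrix_inv \<sigma>" "invertible S"
    by (auto simp: matrix_inv_unique invertible_right_inverse)
  then have ts: "\<tau> ** matrix_inv \<sigma> \<in> N" using star_algebra_inverse(2)[OF N(1) S(1)] by simp
  have "distorted_algebra \<sigma> ((\<lambda>Z. Z ** \<tau>) ` N)"
    unfolding distorted_algebra_def
  proof (intro conjI ballI)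
    show "csubspace ((\<lambda>Z. Z ** \<tau>) ` N)"
      using csubspace_image_mult[OF sN(1), of "mat 1" \<tau>] by simp
    fix X assume "X \<in> (\<lambda>Z. Z ** \<tau>) ` N"
    then obtain Z where Z: "Z \<in> N" "X = Z ** \<tau>" by blast
    have "adj X = adj Z ** \<tau>" using commutantD[OF t(1) sN(3)[OF Z(1)]] by (simp add: Z(2) adj_mult t(2))
    then show "adj X \<in> (\<lambda>Z. Z ** \<tau>) ` N" using sN(3)[OF Z(1)] by blast
    fix Y assume "Y \<in> (\<lambda>Z. Z ** \<tau>) ` N"
    then obtain Z' where Z': "Z' \<in> N" "Y = Z' ** \<tau>" by blast
    have "X ** matrix_inv \<sigma> ** Y = (Z ** (\<tau> ** matrix_inv \<sigma>) ** Z') ** \<tau>"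
      by (simp only: Z Z' matrix_mul_assoc)
    moreover have "Z ** (\<tau> ** matrix_inv \<sigma>) ** Z' \<in> N" by (rule sN(2)[OF sN(2)[OF Z(1) ts] Z'(1)])
    ultimately show "X ** matrix_inv \<sigma> ** Y \<in> (\<lambda>Z. Z ** \<tau>) ` N" by blast
  qed
  then show ?thesis unfolding alg_rho_def using VV by blast
qed

text \<open>As \<open>b\<close> commutes with \<open>N\<close>, conjugating \<open>Z\<close> by the
  root of \<rho> gives \<open>(a ** Z ** a) ** (b ** b)\<close>. Since \<open>a\<close> and its
  inverse lie in \<open>N\<close>, the elements \<open>a ** Z ** a\<close> exhaust \<open>N\<close>,
  which leaves \<open>b ** b\<close> as \<tau>.\<close>

lemma compatible_alg_rho:
  fixes VV :: "'n::finite op set"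
  assumes \<rho>: "posdef \<rho>" "compatible \<rho> (alg (Dinv \<rho> ` VV))" and V: "V \<in> VV" "posdef V"
  obtains N \<tau> where "star_algebra N" "mat 1 \<in> N" "\<tau> \<in> commutant N" "posdef \<tau>"
    "VV \<subseteq> (\<lambda>Z. Z ** \<tau>) ` N" "(\<lambda>Z. Z ** \<tau>) ` N \<subseteq> alg_rho \<rho> VV"
proof -
  define N where "N = alg (Dinv \<rho> ` VV)"
  have N: "star_algebra N" "mat 1 \<in> N"
    using one_in_alg_Dinv[OF \<rho>(1) V] by (simp_all add: N_def star_algebra_alg)
  note sN = star_algebraD[OF N(1)]
  obtain a b where a: "a \<in> N" "posdef a" and b: "b \<in> commutant N" "posdef b"
    and q: "psqrt \<rho> = a ** b"
    using compatible_psqrt[OF N \<rho>(1)] \<rho>(2) unfolding N_def by blast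
  have conj: "psqrt \<rho> ** Z ** psqrt \<rho> = (a ** Z ** a) ** (b ** b)" if "Z \<in> N" for Z
  proof -
    have "psqrt \<rho> ** Z ** psqrt \<rho> = a ** (b ** (Z ** a)) ** b" by (simp only: q matrix_mul_assoc)
    also have "b ** (Z ** a) = (Z ** a) ** b" by (rule commutantD[OF b(1)]) (use that a(1) in \<open>rule sN(2)\<close>)
    finally show ?thesis by (simp only: matrix_mul_assoc)
  qed
  show ?thesis
  proof (rule that[OF N])
    show "b ** b \<in> commutant N"
      by (rule star_algebraD(2)[OF star_algebra_commutant_of_star_algebra[OF N(1)] b(1) b(1)])
    show "posdef (b ** b)"
      using posdef_conj_hermitian[OF posdef_one posdef_invertible posdef_hermitian] b(2) by fastforce
    show "VV \<subseteq> (\<lambda>Z. Z ** (b ** b)) ` N"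
    proof
      fix X assume "X \<in> VV"
      then have Z: "Dinv \<rho> X \<in> N" unfolding N_def using alg_superset by blast
      have "X = (a ** Dinv \<rho> X ** a) ** (b ** b)"
        using conj[OF Z] Dinv_psqrt(1)[OF \<rho>(1)] by simp
      moreover have "a ** Dinv \<rho> X ** a \<in> N" using a(1) Z by (intro sN(2))
      ultimately show "X \<in> (\<lambda>Z. Z ** (b ** b)) ` N" by blast
    qed
    show "(\<lambda>Z. Z ** (b ** b)) ` N \<subseteq> alg_rho \<rho> VV"
    proof clarify
      fix Z assume Z: "Z \<in> N"
      let ?a = "matrix_inv a"
      have ia: "?a \<in> N" by (rule star_algebra_inverse(2)[OF N(1) a(1) posdef_invertible[OF a(2)]])
      have Z': "?a ** Z ** ?a \<in> N" using ia Z by (intro sN(2))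
      have "a ** (?a ** Z ** ?a) ** a = (a ** ?a) ** Z ** (?a ** a)" by (simp only: matrix_mul_assoc)
      then have "a ** (?a ** Z ** ?a) ** a = Z" by (simp add: invertible_inv[OF posdef_invertible[OF a(2)]])
      then have "psqrt \<rho> ** (?a ** Z ** ?a) ** psqrt \<rho> = Z ** (b ** b)" using conj[OF Z'] by simp
      moreover have "psqrt \<rho> ** (?a ** Z ** ?a) ** psqrt \<rho> \<in> alg_rho \<rho> VV"
        by (rule Dinv_alg_rho[OF \<rho>(1)]) (use Z' in \<open>simp add: N_def\<close>)
      ultimately show "Z ** (b ** b) \<in> alg_rho \<rho> VV" by simp
    qed
  qed
qed

text \<open>The commutant of \<open>{\<sigma>}\<close> contains \<open>VV\<close> and, being a
  unital star-algebra through \<sigma>, also the inverse root; hence it contains the generators of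
  the undistorted algebra.\<close>

lemma central_compatible:
  fixes VV :: "'n::finite op set"
  assumes \<sigma>: "posdef \<sigma>" "\<sigma> \<in> commutant VV" and V: "V \<in> VV" "posdef V"
  shows "compatible \<sigma> (alg (Dinv \<sigma> ` VV))"
proof (rule commutant_compatible[OF star_algebra_alg one_in_alg_Dinv[OF \<sigma>(1) V]])
  let ?C = "commutant {\<sigma>}"
  have C: "star_algebra ?C" "mat 1 \<in> ?C" "\<sigma> \<in> ?C"
    by (simp_all add: star_algebra_commutant_hermitian posdef_hermitian[OF \<sigma>(1)] one_in_commutant)
      (simp add: commutant_def)
  have i: "matrix_inv (psqrt \<sigma>) \<in> ?C"
    by (rule star_algebra_inverse(2)[OF C(1) psqrt(3)[OF \<sigma>(1) C] posdef_invertible[OF psqrt(1)[OF \<sigma>(1)]]])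
  have "X \<in> ?C" if "X \<in> VV" for X
    using commutantD[OF \<sigma>(2) that] by (simp add: commutant_def)
  then have "Dinv \<sigma> ` VV \<subseteq> ?C"
    using i by (auto simp: Dinv_def intro!: star_algebraD(2)[OF C(1)])
  then have "alg (Dinv \<sigma> ` VV) \<subseteq> ?C" by (rule alg_minimal[OF C(1)])
  then show "\<sigma> \<in> commutant (alg (Dinv \<sigma> ` VV))"
    unfolding commutant_def by (intro CollectI ballI) (force dest: subsetD)
qed

theorem mainTheorem8:
  fixes VV :: "'n::finite op set" and V :: "'n op"
  assumes "csubspace VV" and "V \<in> VV" and "posdef V"
  defines "\<sigma> \<equiv> hs_proj (center (alg VV)) V"
  shows "posdef \<sigma> \<and> VV \<subseteq> alg_rho \<sigma> VV \<and> compatible \<sigma> (alg (Dinv \<sigma> ` VV)) \<and>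
    (\<forall>\<rho>. posdef \<rho> \<and> compatible \<rho> (alg (Dinv \<rho> ` VV)) \<longrightarrow> alg_rho \<sigma> VV \<subseteq> alg_rho \<rho> VV)"
proof -
  \<comment> \<open>The trivial factorization, with all operators for \<open>N\<close> and the
    identity for \<tau>, makes \<open>M\<close> the whole of \<open>alg VV\<close> and settles
    positivity and centrality without any \<rho>.\<close>
  have \<sigma>: "posdef \<sigma>" "\<sigma> \<in> center (alg VV)"
    using center_projection(1,2)[of UNIV "mat 1" VV V] assms(2,3)
    by (auto simp: \<sigma>_def star_algebra_UNIV one_in_commutant invertible_right_inverse)
  have "\<sigma> \<in> commutant VV"
    using \<sigma>(2) alg_superset[of VV] unfolding center_def commutant_def by blast
  then have "compatible \<sigma> (alg (Dinv \<sigma> ` VV))"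
    by (rule central_compatible[OF \<sigma>(1) _ assms(2,3)])
  moreover have "alg_rho \<sigma> VV \<subseteq> alg_rho \<rho> VV"
    if \<rho>: "posdef \<rho>" "compatible \<rho> (alg (Dinv \<rho> ` VV))" for \<rho>
  proof -
    obtain N \<tau> where N: "star_algebra N" "mat 1 \<in> N" and t: "\<tau> \<in> commutant N" "posdef \<tau>"
      and VV: "VV \<subseteq> (\<lambda>Z. Z ** \<tau>) ` N" and sub: "(\<lambda>Z. Z ** \<tau>) ` N \<subseteq> alg_rho \<rho> VV"
      using compatible_alg_rho[OF \<rho> assms(2,3)] .
    have "\<sigma> \<in> (\<lambda>Z. Z ** \<tau>) ` N"
      unfolding \<sigma>_def
      by (rule center_projection(3)[OF N t(1) posdef_invertible[OF t(2)] VV assms(2,3)])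
    then have "alg_rho \<sigma> VV \<subseteq> (\<lambda>Z. Z ** \<tau>) ` N"
      by (rule alg_rho_subset_of_factorization[OF N t(1) posdef_hermitian[OF t(2)] VV
            posdef_invertible[OF \<sigma>(1)]])
    then show ?thesis using sub by (rule subset_trans)
  qed
  ultimately show ?thesis using \<sigma>(1) alg_rho_superset by blast
qed

end
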